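(* Let $d\ge 2$, let $R\subset X^d$ be a region, let $T\in\Theta$ be a tiling, and let $w:E^d(R)\to\mathbb C$ be any (complex-valued) weight function. Let $K_w$ be the weighted Kasteleyn hypermatrix and $Z_w:=\sum_{Y\in\Theta(R,T)}\prod_{e\in Y\cap E^d(R)}w(e)$ the partition function. Then \[Z_w=\pm\operatorname{Det}K_w .\]
   Context: Fix an integer $d\ge 2$. Let $\mathbf e_1,\dots,\mathbf e_{d+1}$ be the standard basis of $\mathbb R^{d+1}$, $\mathbf n=\mathbf e_1+\dots+\mathbf e_{d+1}$, $H=\mathbf n^\perp\subset\mathbb R^{d+1}$, $P$ the orthogonal projection onto $H$, and $\mathbf g_i=P\mathbf e_i=\mathbf e_i-\mathbf n/(d+1)$. The simplicial lattice $(X^d,E^d)$ is the graph with vertex set $X^d=P(\mathbb Z^{d+1})\subset H$ (equivalently $\mathbb Z^{d+1}/\mathbb Z\mathbf n$) and edges $\{\mathbf x,\mathbf x+\mathbf g_i\}$, $\mathbf x\in X^d$, $1\le i\le d+1$. A (rooted) simplicial loop is a closed path $(\mathbf s_k)_{0\le k\le d+1}$ in $X^d$ with $\mathbf s_k=\mathbf s_{k-1}+\mathbf g_{\xi(k)}$ for some permutation $\xi$ of $\{1,\dots,d+1\}$; an unrooted simplicial loop is such a loop up to cyclic re-indexing, and $U^d$ is the set of these. A tiling is a set $T\subset E^d$ containing exactly one edge of every simplicial loop; $\Theta$ is the set of tilings. A region is a finite set $R\subset X^d$ whose complement $X^d\smallsetminus R$ is connected in $(X^d,E^d)$. $E^d(R)$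 is the set of edges incident to at least one vertex of $R$. $\Theta(R,T):=\{Y\in\Theta:Y\smallsetminus E^d(R)=T\smallsetminus E^d(R)\}$ (a finite set). Each unrooted simplicial loop is indexed so that its first increment is $\mathbf g_{d+1}$, and is identified with the pair $(\mathbf x,\xi)\in X^d\times S_d$ of its starting point $\mathbf x$ and the order $\xi$ in which the remaining increments $\mathbf g_1,\dots,\mathbf g_d$ appear; this gives a bijection $U^d\cong X^d\times S_d$. Fix an enumeration $S_d=\{\xi^1,\dots,\xi^{d!}\}$. For $e\in E^d$, $h(e)\subset U^d$ is the set of unrooted simplicial loops traversing $e$ (the map $e\mapsto h(e)$ is injective, and $h(e)$ contains exactly one loop in $X^d\times\{\xi\}$ for each $\xi\in S_d$); $h(E^d(R))=\{h(e):e\in E^d(R)\}$. For $1\le i\le d!$ let $X_i$ be the set of loops $(\mathbf x,\xi^i)\in X^d\times\{\xi^i\}$ that traverse an edge of $T\cap E^d(R)$; all $X_i$ have the same finite size $n=|T\cap E^d(R)|$. The weighted Kasteleyn hypermatrix is $K_w:X_1\times\dots\times X_{d!}\to\mathbb C$, with $K_w(\mathbf s_1,\dots,\mathbf s_{d!})=w(e)$ if $\{\mathbf s_1,\dots,\mathbf s_{d!}\}=h(e)$ for some (necessarily unique) $e\in E^d(R)$, and $0$ otherwise. Each $X_i$ is identified with $[n]=\{1,\dots,n\}$ through some arbitrary fixed enumeration. For even $m$ and $A:[n]^m\to\mathbb C$, the Cayley hyperdeterminant is \[\operatorname{Det}A:=\sum_{\sigma_2,\dots,\sigma_m\in S_n}\Big(\prod_{i=2}^m\operatorname{Sign}\sigma_i\Big)\prod_{k=1}^nA(k,\sigma_2(k),\dots,\sigma_m(k)).\]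 *)

theory Defs
  imports Complex_Main "HOL-Library.FuncSet" "HOL-Library.Function_Algebras"
    "HOL-Combinatorics.Permutations"
begin

text \<open>A vector of \<open>\<real>\<^sup>d\<^sup>+\<^sup>1\<close> is a function \<open>nat \<Rightarrow> real\<close> that vanishes outside \<open>{1..d+1}\<close>;
  addition is pointwise (\<open>HOL-Library.Function_Algebras\<close>).\<close>

type_synonym vertex = "nat \<Rightarrow> real"
type_synonym edge = "vertex set"
type_synonym rooted_loop = "vertex list"
type_synonym unrooted_loop = "rooted_loop set"

definition basis_vec :: "nat \<Rightarrow> vertex" where
  "basis_vec i = (\<lambda>j. if j = i then 1 else 0)"

definition normal_vec :: "nat \<Rightarrow> vertex" where
  "normal_vec d = (\<Sum>i\<in>{1..d+1}. basis_vec i)"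

text \<open>The orthogonal projection \<open>v - (\<langle>v,n\<rangle> / \<langle>n,n\<rangle>) n\<close>, with \<open>\<langle>v,n\<rangle> = \<Sum>j. v j\<close> and
  \<open>\<langle>n,n\<rangle> = d+1\<close>.\<close>

definition proj :: "nat \<Rightarrow> vertex \<Rightarrow> vertex" where
  "proj d v = (\<lambda>i. v i - (\<Sum>j\<in>{1..d+1}. v j) / real (d+1) * normal_vec d i)"

definition gvec :: "nat \<Rightarrow> nat \<Rightarrow> vertex" where
  "gvec d i = proj d (basis_vec i)"

definition lattice_vertices :: "nat \<Rightarrow> vertex set" where
  "lattice_vertices d =
     proj d ` {z. (\<forall>i\<in>{1..d+1}. z i \<in> \<int>) \<and> (\<forall>i. i \<notin> {1..d+1} \<longrightarrow> z i = 0)}"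

definition lattice_edges :: "nat \<Rightarrow> edge set" where
  "lattice_edges d = {{x, x + gvec d i} | x i. x \<in> lattice_vertices d \<and> i \<in> {1..d+1}}"

text \<open>The list \<open>[s\<^sub>0, \<dots>, s\<^bsub>d+1\<^esub>]\<close> contains the root twice, as its first and as its last entry.\<close>

definition rooted_loops :: "nat \<Rightarrow> rooted_loop set" where
  "rooted_loops d =
     {s. length s = d + 2 \<and> set s \<subseteq> lattice_vertices d \<and> s ! (d+1) = s ! 0 \<and>
         (\<exists>\<xi>. \<xi> permutes {1..d+1} \<and> (\<forall>k\<in>{1..d+1}. s ! k = s ! (k-1) + gvec d (\<xi> k)))}"

definition cyclic_rel :: "nat \<Rightarrow> (rooted_loop \<times> rooted_loop) set" where
  "cyclic_rel d =
     {(s, t). s \<in> rooted_loops d \<and> t \<in> rooted_loops d \<and>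
              (\<exists>j. \<forall>k\<le>d+1. t ! k = s ! ((k + j) mod (d+1)))}"

definition unrooted_loops :: "nat \<Rightarrow> unrooted_loop set" where
  "unrooted_loops d = rooted_loops d // cyclic_rel d"

definition loop_edges :: "nat \<Rightarrow> rooted_loop \<Rightarrow> edge set" where
  "loop_edges d s = {{s ! (k-1), s ! k} | k. k \<in> {1..d+1}}"

definition traverses :: "nat \<Rightarrow> unrooted_loop \<Rightarrow> edge \<Rightarrow> bool" where
  "traverses d u e \<longleftrightarrow> (\<exists>s\<in>u. e \<in> loop_edges d s)"

definition tilings :: "nat \<Rightarrow> edge set set" where
  "tilings d = {T. T \<subseteq> lattice_edges d \<and> (\<forall>s\<in>rooted_loops d. \<exists>!e. e \<in> T \<and> e \<in> loop_edges d s)}"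

definition connected_in_lattice :: "nat \<Rightarrow> vertex set \<Rightarrow> bool" where
  "connected_in_lattice d S \<longleftrightarrow>
     (\<forall>x\<in>S. \<forall>y\<in>S. (x, y) \<in> {(u, v). u \<in> S \<and> v \<in> S \<and> {u, v} \<in> lattice_edges d}\<^sup>*)"

definition region :: "nat \<Rightarrow> vertex set \<Rightarrow> bool" where
  "region d R \<longleftrightarrow> finite R \<and> R \<subseteq> lattice_vertices d \<and> connected_in_lattice d (lattice_vertices d - R)"

definition edges_at :: "nat \<Rightarrow> vertex set \<Rightarrow> edge set" where
  "edges_at d R = {e \<in> lattice_edges d. e \<inter> R \<noteq> {}}"

definition tilings_of :: "nat \<Rightarrow> vertex set \<Rightarrow> edge set \<Rightarrow> edge set set" where
  "tilings_of d R T = {Y \<in> tilings d. Y - edges_at d R = T - edges_at d R}"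

definition partition_function ::
    "nat \<Rightarrow> vertex set \<Rightarrow> edge set \<Rightarrow> (edge \<Rightarrow> complex) \<Rightarrow> complex" where
  "partition_function d R T w = (\<Sum>Y\<in>tilings_of d R T. \<Prod>e\<in>Y \<inter> edges_at d R. w e)"

text \<open>The identification of the pair \<open>(x, \<xi>)\<close>, for \<open>\<xi>\<close> a permutation of \<open>{1..d}\<close>, with an unrooted
  loop: start at \<open>x\<close>, with first increment \<open>g\<^bsub>d+1\<^esub>\<close> and then the increments
  \<open>g\<^bsub>\<xi> 1\<^esub>, \<dots>, g\<^bsub>\<xi> d\<^esub>\<close>.\<close>

definition rooted_loop_of :: "nat \<Rightarrow> vertex \<Rightarrow> (nat \<Rightarrow> nat) \<Rightarrow> rooted_loop" where
  "rooted_loop_of d x \<xi> =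
     map (\<lambda>k. if k = 0 then x else x + gvec d (d+1) + (\<Sum>j\<in>{1..<k}. gvec d (\<xi> j))) [0..<d+2]"

definition loop_of :: "nat \<Rightarrow> vertex \<Rightarrow> (nat \<Rightarrow> nat) \<Rightarrow> unrooted_loop" where
  "loop_of d x \<xi> = cyclic_rel d `` {rooted_loop_of d x \<xi>}"

definition loops_through :: "nat \<Rightarrow> edge \<Rightarrow> unrooted_loop set" where
  "loops_through d e = {u \<in> unrooted_loops d. traverses d u e}"

definition loop_part ::
    "nat \<Rightarrow> vertex set \<Rightarrow> edge set \<Rightarrow> (nat \<Rightarrow> nat) \<Rightarrow> unrooted_loop set" where
  "loop_part d R T \<xi> =
     {loop_of d x \<xi> | x. x \<in> lattice_vertices d \<and>
                         (\<exists>e\<in>T \<inter> edges_at d R. traverses d (loop_of d x \<xi>) e)}"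

text \<open>The Kasteleyn hypermatrix, for a tuple \<open>(s\<^sub>1, \<dots>, s\<^bsub>d!\<^esub>)\<close> given as a function on
  \<open>{1..fact d}\<close>. Only the values of \<open>w\<close> on \<open>edges_at d R\<close> matter.\<close>

definition kasteleyn ::
    "nat \<Rightarrow> vertex set \<Rightarrow> (edge \<Rightarrow> complex) \<Rightarrow> (nat \<Rightarrow> unrooted_loop) \<Rightarrow> complex" where
  "kasteleyn d R w s =
     (if \<exists>e\<in>edges_at d R. s ` {1..fact d} = loops_through d e
      then w (THE e. e \<in> edges_at d R \<and> s ` {1..fact d} = loops_through d e)
      else 0)"

text \<open>The Cayley hyperdeterminant of \<open>A : [n]\<^sup>m \<rightarrow> \<complex>\<close>; index tuples are extensional functions on
  \<open>{1..m}\<close>.\<close>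

definition hyperdet :: "nat \<Rightarrow> nat \<Rightarrow> ((nat \<Rightarrow> nat) \<Rightarrow> complex) \<Rightarrow> complex" where
  "hyperdet m n A =
     (\<Sum>\<sigma> \<in> {2..m} \<rightarrow>\<^sub>E {p. p permutes {1..n}}.
        (\<Prod>i\<in>{2..m}. of_int (sign (\<sigma> i))) *
        (\<Prod>k\<in>{1..n}. A (\<lambda>i\<in>{1..m}. if i = 1 then k else \<sigma> i k)))"

end

theory Submission
  imports Defs
begin

text \<open>
  A set of edges is a tiling iff, for every order \<open>\<xi>\<close>, sending an edge to the unique loop of type
  \<open>\<xi>\<close> through it is a bijection onto the loops of type \<open>\<xi>\<close>. Hence the nonzero terms of the
  hyperdeterminant correspond to the tilings in \<open>\<Theta>(R,T)\<close>, and only the signs are at issue. A tiling has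
  a height function, which along an increment \<open>g\<^sub>i\<close> grows by \<open>1\<close> off the tiling and drops by \<open>d\<close> on it.
  As the complement of \<open>R\<close> is connected, the height functions of two tilings in \<open>\<Theta>(R,T)\<close> can be chosen
  equal off \<open>R\<close>; lowering the larger one at its maxima then shows that the tilings are connected by
  flips, which replace the \<open>d + 1\<close> edges leaving a vertex of \<open>R\<close> by the \<open>d + 1\<close> edges entering it.
  For every \<open>\<xi>\<close> a flip moves the loops of type \<open>\<xi>\<close> by a single \<open>(d + 1)\<close>-cycle, so each of the
  permutations \<open>\<sigma>\<^sub>i\<close> relating loops of two types is multiplied by two cycles and keeps its sign.
\<close>

section \<open>The simplicial lattice\<close>

text \<open>The drop of \<open>d\<close> is forced: a simplicial loop has \<open>d + 1\<close>
  increments and meets a tiling once, so \<open>d\<close> rises by 1 must cancel one drop. Hence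
  every height grows by 1 modulo \<open>d + 1\<close> along every increment, whatever the tiling,
  and two height functions that agree somewhere differ by multiples of \<open>d + 1\<close>, exactly
  the amount by which a flip lowers a value. A flip therefore never overshoots the other height
  function, and the total difference over the finite set \<open>R\<close> is a termination measure.
  That a height exists at all rests on exchanging two successive increments of a path without
  changing its number of tiling edges. Signs are only compared, never computed: type 1 is the
  reference index that the Cayley sum leaves unpermuted, and the cycles induced by a flip for type 1
  and for type \<open>i\<close> are copies of the same shift of positions. The lattice being
  infinite, these permutations act on the \<open>n\<close> labels of the loops that meet
  \<open>T\<close> inside \<open>edges_at d R\<close>.\<close>

abbreviation dirs :: "nat \<Rightarrow> nat set" where
  "dirs d \<equiv> {1..d + 1}"

text \<open>An edge is an unordered pair, but for \<open>d \<ge> 2\<close> its tail and direction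
  can be recovered (\<open>dedge_eq_iff\<close>), so this set can serve as an oriented edge
  throughout.\<close>

definition dedge :: "nat \<Rightarrow> vertex \<Rightarrow> nat \<Rightarrow> edge" where
  "dedge d x i = {x, x + gvec d i}"

section \<open>Coordinates of the increments and relations between them\<close>

lemma sum_fun_apply: "(\<Sum>i\<in>A. f i) x = (\<Sum>i\<in>A. f i x :: 'b::comm_monoid_add)"
  by (induction A rule: infinite_finite_induct) auto

lemma normal_vec_apply: "normal_vec d j = (if j \<in> dirs d then 1 else 0)"
proof -
  have "normal_vec d j = (\<Sum>i\<in>dirs d. if j = i then 1 else 0)"
    by (simp only: normal_vec_def sum_fun_apply basis_vec_def)
  also have "\<dots> = (if j \<in> dirs d then 1 else 0)"
    by (simp only: sum.delta' finite_atLeastAtMost)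
  finally show ?thesis .
qed

lemma proj_apply:
  "proj d v j = v j - (if j \<in> dirs d then (\<Sum>j\<in>dirs d. v j) / real (d + 1) else 0)"
  unfolding proj_def normal_vec_apply by auto

lemma gvec_apply:
  assumes "i \<in> dirs d"
  shows "gvec d i j =
    (if j \<in> dirs d then (if j = i then 1 else 0) - 1 / real (d + 1) else 0)"
proof -
  have "(\<Sum>j\<in>dirs d. basis_vec i j) = 1"
    unfolding basis_vec_def using assms by (subst sum.delta) auto
  then show ?thesis
    unfolding gvec_def proj_apply using assms by (auto simp: basis_vec_def)
qed

lemma sum_gvec_apply:
  assumes "A \<subseteq> dirs d" "j \<in> dirs d"
  shows "(\<Sum>i\<in>A. gvec d i) j = (if j \<in> A then 1 else 0) - real (card A) / real (d + 1)"
proof -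
  have fin: "finite A" using assms(1) finite_subset by blast
  have "(\<Sum>i\<in>A. gvec d i) j = (\<Sum>i\<in>A. (if j = i then 1 else 0) - 1 / real (d + 1))"
    unfolding sum_fun_apply using assms by (intro sum.cong refl) (auto simp: gvec_apply)
  then show ?thesis using fin by (simp add: sum_subtractf)
qed

lemma sum_gvec_outside: "A \<subseteq> dirs d \<Longrightarrow> j \<notin> dirs d \<Longrightarrow> (\<Sum>i\<in>A. gvec d i) j = 0"
  unfolding sum_fun_apply by (intro sum.neutral ballI) (subst gvec_apply, auto)

lemma sum_gvec_all: "(\<Sum>i\<in>dirs d. gvec d i) = 0"
proof
  fix j show "(\<Sum>i\<in>dirs d. gvec d i) j = 0 j"
    using sum_gvec_apply[of "dirs d" d j] sum_gvec_outside[of "dirs d" d j]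
    by (cases "j \<in> dirs d") auto
qed

text \<open>A direction inside \<open>A\<close> and one outside give coordinates of the sum that
  differ by 1, so they cannot both vanish. This keeps the vertices of a simplicial loop
  distinct.\<close>

lemma sum_gvec_eq_0D:
  assumes "A \<subseteq> dirs d" "(\<Sum>i\<in>A. gvec d i) = 0"
  shows "A = {} \<or> A = dirs d"
proof (rule ccontr)
  assume "\<not> ?thesis"
  then obtain j k where "j \<in> A" "k \<in> dirs d" "k \<notin> A" using assms(1) by blast
  moreover have "(\<Sum>i\<in>A. gvec d i) j = 0" "(\<Sum>i\<in>A. gvec d i) k = 0"
    using assms(2) by (simp_all add: fun_eq_iff)
  ultimately show False
    using sum_gvec_apply[of A d j] sum_gvec_apply[of A d k] assms(1) by auto
qed

lemma gvec_nonzero: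
  assumes "2 \<le> d" "i \<in> dirs d"
  shows "gvec d i \<noteq> 0"
proof
  assume "gvec d i = 0"
  then have "{i} = dirs d" using sum_gvec_eq_0D[of "{i}" d] assms by auto
  then have "card (dirs d) = card {i}" by simp
  then show False using assms by simp
qed

text \<open>\<open>d \<ge> 2\<close> provides a third direction \<open>k\<close>, in which both
  increments have the negative coordinate \<open>- 1 / (d + 1)\<close>. This excludes that an
  increment runs back along another one.\<close>

lemma gvec_add_nonzero:
  assumes "2 \<le> d" "i \<in> dirs d" "j \<in> dirs d"
  shows "gvec d i + gvec d j \<noteq> 0"
proof
  assume eq: "gvec d i + gvec d j = 0"
  have "\<exists>k\<in>{1, 2, 3}. k \<noteq> i \<and> k \<noteq> j" by auto
  then obtain k where "k \<in> {1, 2, 3}" "k \<noteq> i" "k \<noteq> j" by blast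
  moreover from this have "k \<in> dirs d" using assms(1) by auto
  moreover have "gvec d i k + gvec d j k = 0" using eq by (simp add: fun_eq_iff)
  ultimately show False using assms by (simp add: gvec_apply)
qed

lemma gvec_inj:
  assumes "i \<in> dirs d" "j \<in> dirs d" "gvec d i = gvec d j"
  shows "i = j"
  using fun_cong[OF assms(3), of i] gvec_apply[OF assms(1), of i] gvec_apply[OF assms(2), of i] assms(1)
  by (auto split: if_splits)

text \<open>Equal pairs match either tail to tail or tail to head; in the second case the two
  increments would cancel.\<close>

lemma dedge_eq_iff:
  assumes "2 \<le> d" "i \<in> dirs d" "j \<in> dirs d"
  shows "dedge d x i = dedge d y j \<longleftrightarrow> x = y \<and> i = j"
proof
  assume eq: "dedge d x i = dedge d y j"
  show "x = y \<and> i = j"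
  proof (cases "x = y")
    case True
    then have "gvec d i = gvec d j"
      using eq gvec_nonzero[OF assms(1,2)] by (auto simp: dedge_def doubleton_eq_iff)
    then show ?thesis using True gvec_inj assms by blast
  next
    case False
    then have "x = y + gvec d j" "y = x + gvec d i"
      using eq by (auto simp: dedge_def doubleton_eq_iff)
    then have "x + (gvec d i + gvec d j) = x" by (metis add.assoc)
    then show ?thesis using gvec_add_nonzero[OF assms] by (metis add_cancel_left_right)
  qed
qed auto

section \<open>The lattice as a group generated by the increments\<close>

lemma proj_add: "proj d (u + v) = proj d u + proj d v"
proof
  fix j show "proj d (u + v) j = (proj d u + proj d v) j"
    unfolding plus_fun_apply proj_apply by (simp add: sum.distrib add_divide_distrib)
qed

lemma proj_diff: "proj d (u - v) = proj d u - proj d v"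
  using proj_add[of d "u - v" v] by (simp add: algebra_simps)

lemma zero_lattice: "0 \<in> lattice_vertices d"
proof -
  have "proj d 0 = 0" using proj_diff[of d 0 0] by simp
  then show ?thesis unfolding lattice_vertices_def by (intro image_eqI[of _ _ 0]) auto
qed

lemma gvec_lattice: "i \<in> dirs d \<Longrightarrow> gvec d i \<in> lattice_vertices d"
  unfolding gvec_def lattice_vertices_def by (intro imageI) (auto simp: basis_vec_def)

lemma lattice_add:
  assumes "x \<in> lattice_vertices d" "y \<in> lattice_vertices d"
  shows "x + y \<in> lattice_vertices d"
proof -
  obtain u v where "x = proj d u" "y = proj d v"
    "\<forall>i\<in>dirs d. u i \<in> \<int>" "\<forall>i. i \<notin> dirs d \<longrightarrow> u i = 0"
    "\<forall>i\<in>dirs d. v i \<in> \<int>" "\<forall>i. i \<notin> dirs d \<longrightarrow> v i = 0"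
    using assms unfolding lattice_vertices_def by blast
  then show ?thesis unfolding lattice_vertices_def
    by (intro image_eqI[of _ _ "u + v"]) (simp_all add: proj_add)
qed

lemma lattice_diff:
  assumes "x \<in> lattice_vertices d" "y \<in> lattice_vertices d"
  shows "x - y \<in> lattice_vertices d"
proof -
  obtain u v where "x = proj d u" "y = proj d v"
    "\<forall>i\<in>dirs d. u i \<in> \<int>" "\<forall>i. i \<notin> dirs d \<longrightarrow> u i = 0"
    "\<forall>i\<in>dirs d. v i \<in> \<int>" "\<forall>i. i \<notin> dirs d \<longrightarrow> v i = 0"
    using assms unfolding lattice_vertices_def by blast
  then show ?thesis unfolding lattice_vertices_def
    by (intro image_eqI[of _ _ "u - v"]) (simp_all add: proj_diff)
qed

lemma lattice_sum:
  "(\<And>i. i \<in> A \<Longrightarrow> f i \<in> lattice_vertices d) \<Longrightarrow> (\<Sum>i\<in>A. f i) \<in> lattice_vertices d"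
  by (induction A rule: infinite_finite_induct) (auto intro: zero_lattice lattice_add)

abbreviation gsum :: "nat \<Rightarrow> nat list \<Rightarrow> vertex" where
  "gsum d L \<equiv> sum_list (map (gvec d) L)"

lemma gsum_lattice: "set L \<subseteq> dirs d \<Longrightarrow> gsum d L \<in> lattice_vertices d"
  by (induction L) (auto intro!: zero_lattice lattice_add gvec_lattice)

lemma gsum_apply:
  assumes "set L \<subseteq> dirs d" "j \<in> dirs d"
  shows "gsum d L j = real (count_list L j) - real (length L) / real (d + 1)"
  using assms(1)
proof (induction L)
  case (Cons i L)
  then show ?case using assms(2) gvec_apply[of i d j]
    by (auto simp: field_simps)
qed auto

lemma gsum_apply_outside: "set L \<subseteq> dirs d \<Longrightarrow> j \<notin> dirs d \<Longrightarrow> gsum d L j = 0"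
  by (induction L) (auto simp: gvec_apply)

lemma lattice_generated:
  assumes "x \<in> lattice_vertices d"
  obtains L where "set L \<subseteq> dirs d" "x = gsum d L"
proof -
  obtain z where z: "x = proj d z" "\<forall>i\<in>dirs d. z i \<in> \<int>" "\<forall>i. i \<notin> dirs d \<longrightarrow> z i = 0"
    using assms unfolding lattice_vertices_def by blast
  \<comment> \<open>Adding a multiple of \<open>normal_vec d\<close> to \<open>z\<close> does not
    change the projection. Shifting by the minimum makes every coordinate a natural number, so
    forward increments alone reach \<open>x\<close>.\<close>
  define m where "m = Min (z ` dirs d)"
  have m: "m \<in> z ` dirs d" "\<And>i. i \<in> dirs d \<Longrightarrow> m \<le> z i"
    unfolding m_def by (intro Min_in Min_le; auto)+
  define c where "c i = nat \<lfloor>z i - m\<rfloor>" for i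
  have c: "real (c i) = z i - m" if "i \<in> dirs d" for i
  proof -
    have "z i - m \<in> \<int>" using m(1) z(2) that by auto
    then show ?thesis using m(2)[OF that] unfolding c_def by (auto elim!: Ints_cases)
  qed
  define L where "L = concat (map (\<lambda>i. replicate (c i) i) [1..<d + 2])"
  have L: "set L \<subseteq> dirs d" unfolding L_def by auto
  have replicate: "count_list (replicate k i) j = (if i = j then k else 0)" for k i j :: nat
    by (induction k) auto
  have "count_list (concat (map (\<lambda>i. replicate (c i) i) xs)) j =
      (if j \<in> set xs then c j else 0)" if "distinct xs" for xs j
    using that by (induction xs) (auto simp: replicate)
  from this[of "[1..<d + 2]"] have count: "count_list L j = c j" if "j \<in> dirs d" for j
    unfolding L_def using that by (simp del: upt_Suc)
  have len: "length L = (\<Sum>i\<in>dirs d. c i)"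
  proof -
    have "{1..<d + 2} = dirs d" by auto
    then show ?thesis unfolding L_def
      by (simp add: length_concat comp_def interv_sum_list_conv_sum_set_nat del: upt_Suc)
  qed
  have "real (length L) = (\<Sum>i\<in>dirs d. z i) - real (d + 1) * m"
    unfolding len of_nat_sum by (simp add: c sum_subtractf)
  then have len': "(\<Sum>i\<in>dirs d. z i) / real (d + 1) = real (length L) / real (d + 1) + m"
    by (simp add: field_simps)
  have "x = gsum d L"
  proof
    fix j show "x j = gsum d L j"
    proof (cases "j \<in> dirs d")
      case True
      then show ?thesis unfolding z(1) proj_apply gsum_apply[OF L True] count[OF True] c[OF True] len'
        by simp
    next
      case False
      then show ?thesis unfolding z(1) proj_apply gsum_apply_outside[OF L False]
        using z(3) by auto
    qed
  qed
  then show thesis using that L by blast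
qed

lemma lattice_edges_iff:
  "e \<in> lattice_edges d \<longleftrightarrow> (\<exists>x\<in>lattice_vertices d. \<exists>i\<in>dirs d. e = dedge d x i)"
  unfolding lattice_edges_def dedge_def by blast

section \<open>Simplicial loops\<close>

text \<open>From here on vertices are mostly handled as elements of an abelian group, and unfolding
  sums pointwise would obstruct this.\<close>

lemmas [simp del] = plus_fun_apply

text \<open>The direction of the \<open>j\<close>-th edge, counted from \<open>0\<close>, of the loop \<open>(x, \<xi>)\<close>, and the position
  of the start of this edge relative to \<open>x\<close>.\<close>

definition step :: "nat \<Rightarrow> (nat \<Rightarrow> nat) \<Rightarrow> nat \<Rightarrow> nat" where
  "step d \<xi> j = (if j = 0 then d + 1 else \<xi> j)"

definition offset :: "nat \<Rightarrow> (nat \<Rightarrow> nat) \<Rightarrow> nat \<Rightarrow> vertex" where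
  "offset d \<xi> j = (\<Sum>l<j. gvec d (step d \<xi> l))"

lemma offset_0 [simp]: "offset d \<xi> 0 = 0"
  and offset_Suc: "offset d \<xi> (Suc j) = offset d \<xi> j + gvec d (step d \<xi> j)"
  by (simp_all add: offset_def)

lemma bij_step:
  assumes "\<xi> permutes {1..d}"
  shows "bij_betw (step d \<xi>) {..d} (dirs d)"
proof -
  have "bij_betw \<xi> {1..d} {1..d}" using assms by (rule permutes_imp_bij)
  then have "bij_betw (step d \<xi>) {1..d} {1..d}"
    by (rule iffD1[OF bij_betw_cong, rotated]) (auto simp: step_def)
  moreover have "bij_betw (step d \<xi>) {0} {d + 1}" by (simp add: step_def)
  ultimately have "bij_betw (step d \<xi>) ({1..d} \<union> {0}) ({1..d} \<union> {d + 1})"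
    by (rule bij_betw_combine) auto
  moreover have "{1..d} \<union> {0} = {..d}" "{1..d} \<union> {d + 1} = dirs d" by auto
  ultimately show ?thesis by simp
qed

lemma step_mem: "\<xi> permutes {1..d} \<Longrightarrow> j \<le> d \<Longrightarrow> step d \<xi> j \<in> dirs d"
  using bij_betwE[OF bij_step] by blast

lemma step_surj:
  assumes "\<xi> permutes {1..d}" "i \<in> dirs d"
  obtains j where "j \<le> d" "step d \<xi> j = i"
  using bij_betw_imp_surj_on[OF bij_step[OF assms(1)]] assms(2) by (metis atMost_iff imageE)

lemma step_inj:
  "\<xi> permutes {1..d} \<Longrightarrow> j \<le> d \<Longrightarrow> k \<le> d \<Longrightarrow> step d \<xi> j = step d \<xi> k \<Longrightarrow> j = k"
  using inj_onD[OF bij_betw_imp_inj_on[OF bij_step]] by (metis atMost_iff)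

lemma offset_full:
  assumes "\<xi> permutes {1..d}"
  shows "offset d \<xi> (d + 1) = 0"
proof -
  have "offset d \<xi> (d + 1) = (\<Sum>l\<in>{..d}. gvec d (step d \<xi> l))"
    unfolding offset_def by (simp add: lessThan_Suc_atMost)
  also have "\<dots> = (\<Sum>i\<in>dirs d. gvec d i)"
    by (rule sum.reindex_bij_betw[OF bij_step[OF assms]])
  finally show ?thesis by (simp only: sum_gvec_all)
qed

lemma offset_lattice:
  "\<xi> permutes {1..d} \<Longrightarrow> j \<le> d + 1 \<Longrightarrow> offset d \<xi> j \<in> lattice_vertices d"
  unfolding offset_def by (intro lattice_sum gvec_lattice step_mem) auto

text \<open>The difference of the two offsets is the sum of a nonempty proper subset of the
  increments, hence nonzero by \<open>sum_gvec_eq_0D\<close>.\<close>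

lemma offset_less:
  assumes "\<xi> permutes {1..d}" "j < k" "k \<le> d"
  shows "offset d \<xi> j \<noteq> offset d \<xi> k"
proof
  assume eq: "offset d \<xi> j = offset d \<xi> k"
  let ?A = "step d \<xi> ` {j..<k}"
  have inj: "inj_on (step d \<xi>) {j..<k}"
    using assms by (intro inj_on_subset[OF bij_betw_imp_inj_on[OF bij_step]]) auto
  have "{..<k} = {..<j} \<union> {j..<k}" using assms(2) by auto
  then have "offset d \<xi> k = offset d \<xi> j + (\<Sum>l\<in>{j..<k}. gvec d (step d \<xi> l))"
    unfolding offset_def by (simp add: sum.union_disjoint ivl_disj_int)
  then have "(\<Sum>i\<in>?A. gvec d i) = 0" using eq by (simp add: sum.reindex[OF inj])
  moreover have "?A \<subseteq> dirs d" using step_mem[OF assms(1)] assms(3) by fastforce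
  moreover have "card ?A \<noteq> card (dirs d)" using card_image[OF inj] assms by simp
  ultimately show False using sum_gvec_eq_0D[of ?A d] assms(2) by force
qed

lemma offset_inj:
  "\<xi> permutes {1..d} \<Longrightarrow> j \<le> d \<Longrightarrow> k \<le> d \<Longrightarrow> offset d \<xi> j = offset d \<xi> k \<Longrightarrow> j = k"
  using offset_less[of \<xi> d j k] offset_less[of \<xi> d k j] by (cases j k rule: linorder_cases) auto

section \<open>Rooted loops, their rotations, and the normal form that starts in direction
  \<open>d + 1\<close>\<close>

lemma length_rooted_loop_of [simp]: "length (rooted_loop_of d x \<xi>) = d + 2"
  by (simp add: rooted_loop_of_def)

lemma rooted_loop_of_nth:
  assumes "k \<le> d + 1"
  shows "rooted_loop_of d x \<xi> ! k = x + offset d \<xi> k"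
proof (cases k)
  case 0
  then show ?thesis by (simp add: rooted_loop_of_def del: upt_Suc)
next
  case (Suc k')
  have "offset d \<xi> k = gvec d (d + 1) + (\<Sum>l\<in>{1..<k}. gvec d (\<xi> l))"
    unfolding offset_def Suc lessThan_atLeast0
    by (subst sum.atLeast_Suc_lessThan) (auto simp: step_def intro!: sum.cong)
  then show ?thesis using assms Suc by (simp add: rooted_loop_of_def add.assoc del: upt_Suc)
qed

lemma rooted_loops_altdef:
  "s \<in> rooted_loops d \<longleftrightarrow> length s = d + 2 \<and> set s \<subseteq> lattice_vertices d \<and> s ! (d + 1) = s ! 0 \<and>
     (\<exists>\<zeta>. \<zeta> permutes dirs d \<and> (\<forall>k\<le>d. s ! Suc k = s ! k + gvec d (\<zeta> (Suc k))))"
proof -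
  have "(\<forall>k\<in>dirs d. P k (k - 1)) \<longleftrightarrow> (\<forall>k\<le>d. P (Suc k) k)" for P :: "nat \<Rightarrow> nat \<Rightarrow> bool"
  proof (intro iffI ballI allI impI)
    fix k assume "\<forall>k\<le>d. P (Suc k) k" "k \<in> dirs d"
    then show "P k (k - 1)" by (cases k) auto
  qed force
  from this[of "\<lambda>k k'. s ! k = s ! k' + gvec d (_ k)"] show ?thesis
    unfolding rooted_loops_def by simp
qed

lemma loop_edges_altdef: "loop_edges d s = {{s ! k, s ! Suc k} | k. k \<le> d}"
proof -
  have "(\<exists>k. e = {s ! (k - 1), s ! k} \<and> k \<in> dirs d) \<longleftrightarrow> (\<exists>k. e = {s ! k, s ! Suc k} \<and> k \<le> d)"
    for e
  proof
    assume "\<exists>k. e = {s ! (k - 1), s ! k} \<and> k \<in> dirs d"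
    then obtain k where "e = {s ! (k - 1), s ! k}" "k \<in> dirs d" by blast
    then show "\<exists>k. e = {s ! k, s ! Suc k} \<and> k \<le> d" by (intro exI[of _ "k - 1"]) auto
  next
    assume "\<exists>k. e = {s ! k, s ! Suc k} \<and> k \<le> d"
    then obtain k where "e = {s ! k, s ! Suc k}" "k \<le> d" by blast
    then show "\<exists>k. e = {s ! (k - 1), s ! k} \<and> k \<in> dirs d" by (intro exI[of _ "Suc k"]) auto
  qed
  then show ?thesis unfolding loop_edges_def by simp
qed

lemma rooted_loop_of_mem:
  assumes "x \<in> lattice_vertices d" "\<xi> permutes {1..d}"
  shows "rooted_loop_of d x \<xi> \<in> rooted_loops d"
proof -
  \<comment> \<open>Increments are numbered from 1 in \<open>rooted_loops\<close> and from 0 in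
    \<open>step\<close>, hence the shift; outside \<open>dirs d\<close> the identity is what
    \<open>permutes\<close> demands.\<close>
  define \<zeta> where "\<zeta> k = (if k \<in> dirs d then step d \<xi> (k - 1) else k)" for k
  have "bij_betw (\<lambda>k. k - 1) (dirs d) {..d}"
    by (rule bij_betw_byWitness[where f' = Suc]) auto
  then have "bij_betw (step d \<xi> \<circ> (\<lambda>k. k - 1)) (dirs d) (dirs d)"
    using bij_step[OF assms(2)] by (rule bij_betw_trans)
  then have "bij_betw \<zeta> (dirs d) (dirs d)"
    by (rule iffD1[OF bij_betw_cong, rotated]) (auto simp: \<zeta>_def)
  then have "\<zeta> permutes dirs d" by (rule bij_imp_permutes) (auto simp: \<zeta>_def)
  moreover have "rooted_loop_of d x \<xi> ! Suc k = rooted_loop_of d x \<xi> ! k + gvec d (\<zeta> (Suc k))"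
    if "k \<le> d" for k
    using that by (simp add: rooted_loop_of_nth offset_Suc \<zeta>_def add.assoc)
  moreover have "set (rooted_loop_of d x \<xi>) \<subseteq> lattice_vertices d"
    by (auto simp: in_set_conv_nth rooted_loop_of_nth intro!: lattice_add assms offset_lattice)
  ultimately show ?thesis unfolding rooted_loops_altdef
    using offset_full[OF assms(2)] by (auto simp: rooted_loop_of_nth)
qed

lemma rooted_loop_nth_mod:
  assumes "s \<in> rooted_loops d" "k \<le> d + 1"
  shows "s ! (k mod (d + 1)) = s ! k"
  using assms by (cases "k = d + 1") (auto simp: rooted_loops_altdef)

lemma equiv_cyclic_rel: "equiv (rooted_loops d) (cyclic_rel d)"
proof (rule equivI)
  show "cyclic_rel d \<subseteq> rooted_loops d \<times> rooted_loops d" by (auto simp: cyclic_rel_def)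
  show "refl_on (rooted_loops d) (cyclic_rel d)"
    unfolding refl_on_def cyclic_rel_def
    by (auto intro!: exI[of _ 0] simp: rooted_loop_nth_mod[unfolded Suc_eq_plus1[symmetric]])
  show "sym (cyclic_rel d)"
  proof (rule symI)
    fix s t assume "(s, t) \<in> cyclic_rel d"
    then obtain j where st: "s \<in> rooted_loops d" "t \<in> rooted_loops d"
      and j: "\<And>k. k \<le> d + 1 \<Longrightarrow> t ! k = s ! ((k + j) mod (d + 1))"
      unfolding cyclic_rel_def by blast
    \<comment> \<open>Rotating back by \<open>j\<close> is rotating forward by its complement modulo
      \<open>d + 1\<close>, which stays in the naturals.\<close>
    have "s ! k = t ! ((k + (d + 1 - j mod (d + 1))) mod (d + 1))" if "k \<le> d + 1" for k
    proof -
      let ?m = "(k + (d + 1 - j mod (d + 1))) mod (d + 1)"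
      have "?m < d + 1" by simp
      then have "t ! ?m = s ! ((?m + j) mod (d + 1))" by (intro j) simp
      also have "(?m + j) mod (d + 1) = (k + (d + 1 - j mod (d + 1)) + j mod (d + 1)) mod (d + 1)"
        by (simp add: mod_simps)
      also have "\<dots> = (k + (d + 1)) mod (d + 1)"
        using mod_less_divisor[of "d + 1" j] by (simp add: add.assoc del: mod_less_divisor)
      also have "\<dots> = k mod (d + 1)" by (rule mod_add_self2)
      finally show ?thesis using rooted_loop_nth_mod[OF st(1) that] by simp
    qed
    then show "(t, s) \<in> cyclic_rel d" unfolding cyclic_rel_def using st by blast
  qed
  show "trans (cyclic_rel d)"
  proof (rule transI)
    fix s t u assume "(s, t) \<in> cyclic_rel d" "(t, u) \<in> cyclic_rel d"
    then obtain j j' where su: "s \<in> rooted_loops d" "u \<in> rooted_loops d"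
      and j: "\<And>k. k \<le> d + 1 \<Longrightarrow> t ! k = s ! ((k + j) mod (d + 1))"
      and j': "\<And>k. k \<le> d + 1 \<Longrightarrow> u ! k = t ! ((k + j') mod (d + 1))"
      unfolding cyclic_rel_def by blast
    have "u ! k = s ! ((k + (j' + j)) mod (d + 1))" if "k \<le> d + 1" for k
    proof -
      have "(k + j') mod (d + 1) < d + 1" by simp
      then have "t ! ((k + j') mod (d + 1)) = s ! (((k + j') mod (d + 1) + j) mod (d + 1))"
        by (intro j) simp
      then show ?thesis using j'[OF that] by (simp add: mod_simps add.assoc)
    qed
    then show "(s, u) \<in> cyclic_rel d" unfolding cyclic_rel_def using su by blast
  qed
qed

lemma loop_edges_cyclic_subset:
  assumes "(s, t) \<in> cyclic_rel d"
  shows "loop_edges d t \<subseteq> loop_edges d s"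
proof
  fix e assume "e \<in> loop_edges d t"
  then obtain k where k: "k \<le> d" "e = {t ! k, t ! Suc k}" unfolding loop_edges_altdef by blast
  obtain j where s: "s \<in> rooted_loops d"
    and j: "\<And>k. k \<le> d + 1 \<Longrightarrow> t ! k = s ! ((k + j) mod (d + 1))"
    using assms unfolding cyclic_rel_def by blast
  let ?r = "(k + j) mod (d + 1)"
  have r: "?r < d + 1" by simp
  have "t ! Suc k = s ! (Suc ?r mod (d + 1))" using j[of "Suc k"] k(1) by (simp add: mod_simps)
  also have "\<dots> = s ! Suc ?r" using r by (intro rooted_loop_nth_mod s) simp
  finally have "e = {s ! ?r, s ! Suc ?r}" using j[of k] k by simp
  then show "e \<in> loop_edges d s" unfolding loop_edges_altdef using r by (auto simp: less_Suc_eq_le)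
qed

lemma loop_edges_cyclic: "(s, t) \<in> cyclic_rel d \<Longrightarrow> loop_edges d s = loop_edges d t"
  using loop_edges_cyclic_subset equiv_cyclic_rel[THEN equivE] by (metis subset_antisym symD)

lemma traverses_loop_of:
  assumes "x \<in> lattice_vertices d" "\<xi> permutes {1..d}"
  shows "traverses d (loop_of d x \<xi>) e \<longleftrightarrow> e \<in> loop_edges d (rooted_loop_of d x \<xi>)"
  unfolding traverses_def loop_of_def
  using loop_edges_cyclic equiv_class_self[OF equiv_cyclic_rel rooted_loop_of_mem[OF assms]] by blast

text \<open>Starting the loop at its step in direction \<open>d + 1\<close> brings it into normal
  form; this is the surjectivity of the identification of pairs \<open>(x, \<xi>)\<close> with
  unrooted loops.\<close>

lemma rooted_loop_rotate:
  assumes "s \<in> rooted_loops d"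
  obtains x \<xi> where "x \<in> lattice_vertices d" "\<xi> permutes {1..d}"
    "(s, rooted_loop_of d x \<xi>) \<in> cyclic_rel d"
proof -
  obtain \<zeta> where \<zeta>: "\<zeta> permutes dirs d" and s: "\<And>k. k \<le> d \<Longrightarrow> s ! Suc k = s ! k + gvec d (\<zeta> (Suc k))"
    and "length s = d + 2" "set s \<subseteq> lattice_vertices d"
    using assms unfolding rooted_loops_altdef by blast
  then have lat: "s ! k \<in> lattice_vertices d" if "k \<le> d + 1" for k
    using that nth_mem[of k s] by auto
  have "d + 1 \<in> \<zeta> ` dirs d" using permutes_image[OF \<zeta>] by auto
  then obtain k0 where "k0 \<in> dirs d" "\<zeta> k0 = d + 1" by auto
  then obtain j0 where j0: "j0 \<le> d" "\<zeta> (Suc j0) = d + 1" by (cases k0) auto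
  \<comment> \<open>\<open>\<nu> l\<close> is the direction of step \<open>l\<close>, counted from
    0, once the loop starts at \<open>s ! j0\<close>.\<close>
  define \<nu> where "\<nu> l = \<zeta> (Suc ((l + j0) mod (d + 1)))" for l
  define \<xi> where "\<xi> l = (if l \<in> {1..d} then \<nu> l else l)" for l
  have inj: "l = l'" if "\<nu> l = \<nu> l'" "l \<le> d" "l' \<le> d" for l l'
  proof -
    have "(l + j0) mod (d + 1) = (l' + j0) mod (d + 1)"
      using permutes_inj[OF \<zeta>] that(1) unfolding \<nu>_def by (auto dest: injD)
    then have "int (l + j0) mod int (d + 1) = int (l' + j0) mod int (d + 1)"
      by (metis zmod_int)
    then have "int (d + 1) dvd int l - int l'" by (simp add: mod_eq_dvd_iff)
    then have "int l - int l' = 0 \<or> int (d + 1) \<le> \<bar>int l - int l'\<bar>"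
      using dvd_imp_le_int[of "int l - int l'" "int (d + 1)"] by auto
    then show ?thesis using that(2,3) by auto
  qed
  have \<nu>0: "\<nu> 0 = d + 1" using j0 by (simp add: \<nu>_def)
  have \<nu>_mem: "\<nu> l \<in> dirs d" for l
    using permutes_in_image[OF \<zeta>, of "Suc ((l + j0) mod (d + 1))"] mod_less_divisor[of "d + 1" "l + j0"]
    unfolding \<nu>_def by (simp add: less_Suc_eq_le del: mod_less_divisor)
  have "\<xi> ` {1..d} \<subseteq> {1..d}"
  proof
    fix i assume "i \<in> \<xi> ` {1..d}"
    then obtain l where l: "l \<in> {1..d}" "i = \<nu> l" by (auto simp: \<xi>_def)
    then have "\<nu> l \<noteq> d + 1" using inj[of l 0] \<nu>0 by auto
    then show "i \<in> {1..d}" using \<nu>_mem[of l] l by auto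
  qed
  moreover have inj': "inj_on \<xi> {1..d}"
    by (rule inj_onI, rule inj) (auto simp: \<xi>_def)
  ultimately have "\<xi> ` {1..d} = {1..d}" by (intro endo_inj_surj) auto
  then have "bij_betw \<xi> {1..d} {1..d}" using inj' by (simp add: bij_betw_def)
  then have \<xi>: "\<xi> permutes {1..d}" by (rule bij_imp_permutes) (auto simp: \<xi>_def)
  have step: "step d \<xi> k = \<nu> k" if "k \<le> d" for k
    using that \<nu>0 by (auto simp: step_def \<xi>_def)
  let ?t = "rooted_loop_of d (s ! j0) \<xi>"
  have "?t ! k = s ! ((k + j0) mod (d + 1))" if "k \<le> d + 1" for k
    using that
  proof (induction k)
    case 0
    then show ?case using j0 by (simp add: rooted_loop_of_nth)
  next
    case (Suc k)
    let ?r = "(k + j0) mod (d + 1)"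
    have r: "?r < d + 1" by simp
    have "?t ! Suc k = ?t ! k + gvec d (step d \<xi> k)"
      using Suc.prems by (simp add: rooted_loop_of_nth offset_Suc add.assoc)
    also have "\<dots> = s ! ?r + gvec d (\<zeta> (Suc ?r))"
      using Suc step[of k] by (simp add: \<nu>_def)
    also have "\<dots> = s ! Suc ?r" using r by (intro s[symmetric]) simp
    also have "\<dots> = s ! (Suc ?r mod (d + 1))"
      using r by (intro rooted_loop_nth_mod[symmetric] assms) simp
    also have "Suc ?r mod (d + 1) = (Suc k + j0) mod (d + 1)" by (simp add: mod_simps)
    finally show ?case .
  qed
  moreover have "s ! j0 \<in> lattice_vertices d" using lat j0 by simp
  ultimately show thesis using that[of "s ! j0" \<xi>] \<xi> assms rooted_loop_of_mem
    unfolding cyclic_rel_def by blast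
qed

lemma unrooted_loops_iff:
  "u \<in> unrooted_loops d \<longleftrightarrow> (\<exists>x\<in>lattice_vertices d. \<exists>\<xi>. \<xi> permutes {1..d} \<and> u = loop_of d x \<xi>)"
proof
  assume "u \<in> unrooted_loops d"
  then obtain s where s: "s \<in> rooted_loops d" "u = cyclic_rel d `` {s}"
    unfolding unrooted_loops_def by (rule quotientE)
  obtain x \<xi> where "x \<in> lattice_vertices d" "\<xi> permutes {1..d}"
    "(s, rooted_loop_of d x \<xi>) \<in> cyclic_rel d"
    using rooted_loop_rotate[OF s(1)] .
  then show "\<exists>x\<in>lattice_vertices d. \<exists>\<xi>. \<xi> permutes {1..d} \<and> u = loop_of d x \<xi>"
    using equiv_class_eq[OF equiv_cyclic_rel] unfolding loop_of_def s(2) by blast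
next
  assume "\<exists>x\<in>lattice_vertices d. \<exists>\<xi>. \<xi> permutes {1..d} \<and> u = loop_of d x \<xi>"
  then show "u \<in> unrooted_loops d"
    unfolding unrooted_loops_def loop_of_def by (blast intro: quotientI rooted_loop_of_mem)
qed

section \<open>Hyperdeterminants and matchings\<close>

text \<open>The elements of \<open>M\<close> carry two labels; for a perfect matching this is the
  permutation turning the first label into the second, one \<open>\<sigma>\<^sub>i\<close> of the
  hyperdeterminant.\<close>

definition matching_perm :: "nat \<Rightarrow> ('e \<Rightarrow> nat) \<Rightarrow> ('e \<Rightarrow> nat) \<Rightarrow> 'e set \<Rightarrow> nat \<Rightarrow> nat" where
  "matching_perm n p q M k = (if k \<in> {1..n} then q (inv_into M p k) else k)"

lemma matching_perm_apply:
  assumes "bij_betw p M {1..n}" "e \<in> M"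
  shows "matching_perm n p q M (p e) = q e"
  using assms bij_betwE[OF assms(1)] by (simp add: matching_perm_def bij_betw_inv_into_left)

lemma matching_perm_permutes:
  assumes "bij_betw p M {1..n}" "bij_betw q M {1..n}"
  shows "matching_perm n p q M permutes {1..n}"
proof (rule bij_imp_permutes)
  have "bij_betw (q \<circ> inv_into M p) {1..n} {1..n}"
    by (rule bij_betw_trans[OF bij_betw_inv_into[OF assms(1)] assms(2)])
  then show "bij_betw (matching_perm n p q M) {1..n} {1..n}"
    by (rule iffD1[OF bij_betw_cong, rotated]) (simp add: matching_perm_def)
qed (simp only: matching_perm_def if_False)

text \<open>The square between the labels of \<open>M\<close> and those of \<open>M'\<close>
  commutes, as \<open>\<rho>\<close> and \<open>\<rho>'\<close> express \<open>\<beta>\<close> in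
  the two labellings. Their equal signs then cancel.\<close>

lemma sign_matching_perm_cong:
  assumes p: "bij_betw p M {1..n}" "bij_betw p M' {1..n}"
    and q: "bij_betw q M {1..n}" "bij_betw q M' {1..n}"
    and \<beta>: "\<And>e. e \<in> M \<Longrightarrow> \<beta> e \<in> M'"
    and \<rho>: "\<rho> permutes {1..n}" "\<And>e. e \<in> M \<Longrightarrow> \<rho> (p e) = p (\<beta> e)"
    and \<rho>': "\<rho>' permutes {1..n}" "\<And>e. e \<in> M \<Longrightarrow> \<rho>' (q e) = q (\<beta> e)"
    and sgn: "sign \<rho> = sign \<rho>'"
  shows "sign (matching_perm n p q M') = sign (matching_perm n p q M)"
proof -
  let ?\<sigma> = "matching_perm n p q M" and ?\<sigma>' = "matching_perm n p q M'"
  have perm: "permutation \<pi>" if "\<pi> permutes {1..n}" for \<pi>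
    using that by (rule permutes_imp_permutation[rotated]) simp
  have "?\<sigma>' \<circ> \<rho> = \<rho>' \<circ> ?\<sigma>"
  proof
    fix k show "(?\<sigma>' \<circ> \<rho>) k = (\<rho>' \<circ> ?\<sigma>) k"
    proof (cases "k \<in> {1..n}")
      case True
      then obtain e where e: "e \<in> M" "k = p e" using p(1) by (metis bij_betw_iff_bijections)
      then show ?thesis
        using p q \<beta> \<rho>(2) \<rho>'(2) by (simp add: matching_perm_apply)
    next
      case False
      then have "\<rho> k = k" "\<rho>' k = k" using \<rho>(1) \<rho>'(1) by (metis permutes_not_in)+
      then show ?thesis using False by (auto simp: matching_perm_def)
    qed
  qed
  then have "sign ?\<sigma>' * sign \<rho> = sign \<rho>' * sign ?\<sigma>"
    using \<rho>(1) \<rho>'(1) matching_perm_permutes[OF p(1) q(1)] matching_perm_permutes[OF p(2) q(2)]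
    by (metis perm sign_compose)
  then show ?thesis using sgn by simp
qed

text \<open>The nonzero terms of the hyperdeterminant of a matrix supported on the tuples
  \<open>(P 1 e, \<dots>, P m e)\<close> correspond to the perfect matchings \<open>M\<close>.\<close>

lemma hyperdet_matchings:
  fixes P :: "nat \<Rightarrow> 'e \<Rightarrow> nat" and w :: "'e \<Rightarrow> complex" and s :: "nat \<Rightarrow> int"
  assumes m: "1 \<le> m"
    and MM: "\<And>M. M \<in> MM \<longleftrightarrow> M \<subseteq> F \<and> (\<forall>i\<in>{1..m}. bij_betw (P i) M {1..n})"
    and inj: "\<And>e e'. e \<in> F \<Longrightarrow> e' \<in> F \<Longrightarrow> (\<And>i. i \<in> {1..m} \<Longrightarrow> P i e = P i e') \<Longrightarrow> e = e'"
    and A_eq: "\<And>e t. e \<in> F \<Longrightarrow> (\<And>i. i \<in> {1..m} \<Longrightarrow> t i = P i e) \<Longrightarrow> A t = w e"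
    and A_0: "\<And>t. (\<And>i. i \<in> {1..m} \<Longrightarrow> t i \<in> {1..n}) \<Longrightarrow>
      \<not> (\<exists>e\<in>F. \<forall>i\<in>{1..m}. t i = P i e) \<Longrightarrow> A t = 0"
    and sgn: "\<And>M i. M \<in> MM \<Longrightarrow> i \<in> {2..m} \<Longrightarrow> sign (matching_perm n (P 1) (P i) M) = s i"
  shows "hyperdet m n A = (\<Prod>i\<in>{2..m}. of_int (s i)) * (\<Sum>M\<in>MM. \<Prod>e\<in>M. w e)"
proof -
  let ?S = "{2..m} \<rightarrow>\<^sub>E {p. p permutes {1..n}}"
  define idx where "idx \<sigma> k = (\<lambda>i\<in>{1..m}. if i = 1 then k else \<sigma> i k)" for \<sigma> :: "nat \<Rightarrow> nat \<Rightarrow> nat" and k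
  have idx_1: "idx \<sigma> k 1 = k" for \<sigma> k using m by (simp add: idx_def)
  have idx_2: "idx \<sigma> k i = \<sigma> i k" if "i \<in> {2..m}" for \<sigma> k i using that by (simp add: idx_def)
  have all_idx: "(\<forall>i\<in>{1..m}. Q i) \<longleftrightarrow> Q 1 \<and> (\<forall>i\<in>{2..m}. Q i)" for Q
  proof -
    have "{1..m} = insert 1 {2..m}" using m by auto
    then show ?thesis by simp
  qed
  define summand where "summand \<sigma> = (\<Prod>i\<in>{2..m}. of_int (sign (\<sigma> i))) * (\<Prod>k\<in>{1..n}. A (idx \<sigma> k))"
    for \<sigma> :: "nat \<Rightarrow> nat \<Rightarrow> nat"
  \<comment> \<open>Outside \<open>G\<close> some factor of the product vanishes;
    \<open>\<Phi>\<close> and \<open>\<Psi>\<close> are mutually inverse between the matchings in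
    \<open>MM\<close> and \<open>G\<close>.\<close>
  define G where "G = {\<sigma> \<in> ?S. \<forall>k\<in>{1..n}. \<exists>e\<in>F. \<forall>i\<in>{1..m}. idx \<sigma> k i = P i e}"
  define \<Phi> where "\<Phi> M = (\<lambda>i\<in>{2..m}. matching_perm n (P 1) (P i) M)" for M
  define \<Psi> where "\<Psi> \<sigma> = {e \<in> F. \<exists>k\<in>{1..n}. \<forall>i\<in>{1..m}. idx \<sigma> k i = P i e}" for \<sigma>
  have bij: "bij_betw (P i) M {1..n}" if "M \<in> MM" "i \<in> {1..m}" for M i using MM that by blast
  have sub: "M \<subseteq> F" if "M \<in> MM" for M using MM that by blast
  have idx_\<Phi>: "idx (\<Phi> M) (P 1 e) i = P i e" if "M \<in> MM" "e \<in> M" "i \<in> {1..m}" for M e i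
    using that(3) matching_perm_apply[OF bij[OF that(1)] that(2), of 1] m
    by (auto simp: idx_def \<Phi>_def)
  have \<Phi>_S: "\<Phi> M \<in> ?S" if "M \<in> MM" for M
    unfolding \<Phi>_def restrict_PiE_iff mem_Collect_eq
    by (intro ballI matching_perm_permutes bij that) (use m in auto)
  have \<Psi>_\<Phi>: "\<Psi> (\<Phi> M) = M" if M: "M \<in> MM" for M
  proof (intro equalityI subsetI)
    fix e assume e: "e \<in> M"
    have "P 1 e \<in> {1..n}" using bij_betwE[OF bij[OF M]] e m by force
    then show "e \<in> \<Psi> (\<Phi> M)" unfolding \<Psi>_def using idx_\<Phi>[OF M e] sub[OF M] e by blast
  next
    fix e assume "e \<in> \<Psi> (\<Phi> M)"
    then obtain k where k: "e \<in> F" "k \<in> {1..n}" "\<forall>i\<in>{1..m}. idx (\<Phi> M) k i = P i e"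
      unfolding \<Psi>_def by blast
    obtain e' where e': "e' \<in> M" "k = P 1 e'"
      using bij[OF M, of 1] k(2) m by (metis atLeastAtMost_iff bij_betw_iff_bijections order_refl)
    then have "e = e'" using k sub[OF M] idx_\<Phi>[OF M e'(1)] by (intro inj) auto
    then show "e \<in> M" using e' by simp
  qed
  have \<Psi>_MM: "\<Psi> \<sigma> \<in> MM" if \<sigma>: "\<sigma> \<in> G" for \<sigma>
    unfolding MM
  proof (intro conjI ballI)
    show "\<Psi> \<sigma> \<subseteq> F" by (auto simp: \<Psi>_def)
    fix i assume i: "i \<in> {1..m}"
    \<comment> \<open>Coordinate 1 is the identity and the others are permutations, so every
      coordinate of the \<open>n\<close> tuples takes each value once.\<close>
    have idx_bij: "bij_betw (\<lambda>k. idx \<sigma> k i) {1..n} {1..n}"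
    proof (cases "i = 1")
      case True
      then show ?thesis using m idx_1[of \<sigma>] by (simp add: bij_betw_id[unfolded id_def])
    next
      case False
      then have "i \<in> {2..m}" using i by auto
      then have "\<sigma> i permutes {1..n}" using \<sigma> by (auto simp: G_def)
      then show ?thesis using permutes_imp_bij idx_2[OF \<open>i \<in> {2..m}\<close>, of \<sigma>] by simp
    qed
    show "bij_betw (P i) (\<Psi> \<sigma>) {1..n}"
      unfolding bij_betw_def
    proof (intro conjI inj_onI equalityI subsetI)
      fix e e' assume "e \<in> \<Psi> \<sigma>" "e' \<in> \<Psi> \<sigma>" and eq: "P i e = P i e'"
      then obtain k k' where k: "e \<in> F" "k \<in> {1..n}" "\<forall>i\<in>{1..m}. idx \<sigma> k i = P i e"
        and k': "e' \<in> F" "k' \<in> {1..n}" "\<forall>i\<in>{1..m}. idx \<sigma> k' i = P i e'"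
        unfolding \<Psi>_def by blast
      have "idx \<sigma> k i = idx \<sigma> k' i" using k k' i eq by simp
      then have "k = k'" using idx_bij k k' by (auto simp: bij_betw_def dest: inj_onD)
      then show "e = e'" using k k' by (intro inj) auto
    next
      fix y assume "y \<in> P i ` \<Psi> \<sigma>"
      then obtain e k where "y = P i e" "k \<in> {1..n}" "\<forall>i\<in>{1..m}. idx \<sigma> k i = P i e"
        unfolding \<Psi>_def by blast
      then show "y \<in> {1..n}" using idx_bij i by (metis bij_betwE)
    next
      fix y assume "y \<in> {1..n}"
      then obtain k where k: "k \<in> {1..n}" "y = idx \<sigma> k i" using idx_bij by (metis bij_betw_iff_bijections)
      then obtain e where "e \<in> F" "\<forall>i\<in>{1..m}. idx \<sigma> k i = P i e" using \<sigma> unfolding G_def by blast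
      then show "y \<in> P i ` \<Psi> \<sigma>" unfolding \<Psi>_def using k i by (intro image_eqI[of _ _ e]) auto
    qed
  qed
  have \<Phi>_\<Psi>: "\<Phi> (\<Psi> \<sigma>) = \<sigma>" if \<sigma>: "\<sigma> \<in> G" for \<sigma>
  proof (rule PiE_ext[where k = "{2..m}"])
    show "\<Phi> (\<Psi> \<sigma>) \<in> ?S" using \<Phi>_S \<Psi>_MM[OF \<sigma>] by blast
    show "\<sigma> \<in> ?S" using \<sigma> by (simp add: G_def)
    fix i assume i: "i \<in> {2..m}"
    have perms: "\<sigma> i permutes {1..n}" "\<Phi> (\<Psi> \<sigma>) i permutes {1..n}"
      using i \<open>\<sigma> \<in> ?S\<close> \<open>\<Phi> (\<Psi> \<sigma>) \<in> ?S\<close> by auto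
    show "\<Phi> (\<Psi> \<sigma>) i = \<sigma> i"
    proof
      fix k show "\<Phi> (\<Psi> \<sigma>) i k = \<sigma> i k"
      proof (cases "k \<in> {1..n}")
        case True
        then obtain e where e: "e \<in> F" "\<forall>i\<in>{1..m}. idx \<sigma> k i = P i e"
          using \<sigma> unfolding G_def by blast
        then have "e \<in> \<Psi> \<sigma>" using True unfolding \<Psi>_def by blast
        moreover have "1 \<in> {1..m}" "i \<in> {1..m}" using i m by auto
        then have "P 1 e = k" "P i e = \<sigma> i k"
          using e(2) idx_1[of \<sigma> k] idx_2[OF i, of \<sigma> k] by metis+
        ultimately show ?thesis
          using idx_\<Phi>[OF \<Psi>_MM[OF \<sigma>], of e i] idx_2[OF i, of "\<Phi> (\<Psi> \<sigma>)" k] i by simp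
      next
        case False
        then show ?thesis using perms by (metis permutes_not_in)
      qed
    qed
  qed
  have \<Phi>_G: "\<Phi> M \<in> G" if M: "M \<in> MM" for M
    unfolding G_def
  proof (intro CollectI conjI ballI)
    fix k assume "k \<in> {1..n}"
    then obtain e where "e \<in> M" "k = P 1 e"
      using bij[OF M, of 1] m by (metis atLeastAtMost_iff bij_betw_iff_bijections order_refl)
    then show "\<exists>e\<in>F. \<forall>i\<in>{1..m}. idx (\<Phi> M) k i = P i e" using idx_\<Phi>[OF M] sub[OF M] by blast
  qed (rule \<Phi>_S[OF M])
  have "bij_betw \<Phi> MM G"
    by (rule bij_betw_byWitness[where f' = \<Psi>]) (use \<Psi>_\<Phi> \<Phi>_\<Psi> \<Phi>_G \<Psi>_MM in blast)+
  have summand_\<Phi>: "summand (\<Phi> M) = (\<Prod>i\<in>{2..m}. of_int (s i)) * (\<Prod>e\<in>M. w e)" if M: "M \<in> MM" for M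
  proof -
    have "(\<Prod>k\<in>{1..n}. A (idx (\<Phi> M) k)) = (\<Prod>e\<in>M. A (idx (\<Phi> M) (P 1 e)))"
      using bij[OF M, of 1] m by (intro prod.reindex_bij_betw[symmetric]) simp
    also have "\<dots> = (\<Prod>e\<in>M. w e)"
      using idx_\<Phi>[OF M] sub[OF M] by (intro prod.cong refl A_eq) auto
    finally show ?thesis unfolding summand_def using sgn[OF M] by (simp add: \<Phi>_def)
  qed
  have "hyperdet m n A = (\<Sum>\<sigma>\<in>?S. summand \<sigma>)"
    by (simp only: hyperdet_def summand_def idx_def)
  also have "\<dots> = (\<Sum>\<sigma>\<in>G. summand \<sigma>)"
  proof (rule sum.mono_neutral_right)
    show "finite ?S" by (intro finite_PiE finite_permutations) auto
    show "G \<subseteq> ?S" by (auto simp: G_def)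
    show "\<forall>\<sigma>\<in>?S - G. summand \<sigma> = 0"
    proof
      fix \<sigma> assume \<sigma>: "\<sigma> \<in> ?S - G"
      then obtain k where k: "k \<in> {1..n}" "\<not> (\<exists>e\<in>F. \<forall>i\<in>{1..m}. idx \<sigma> k i = P i e)"
        unfolding G_def by blast
      have "\<forall>i\<in>{1..m}. idx \<sigma> k i \<in> {1..n}"
        unfolding all_idx
      proof (intro conjI ballI)
        show "idx \<sigma> k 1 \<in> {1..n}" using k(1) idx_1 by simp
        fix i assume i: "i \<in> {2..m}"
        then have "\<sigma> i permutes {1..n}" using \<sigma> by auto
        then show "idx \<sigma> k i \<in> {1..n}" using permutes_in_image k(1) idx_2[OF i] by metis
      qed
      then have "A (idx \<sigma> k) = 0" using k(2) by (intro A_0) auto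
      then have "(\<Prod>k\<in>{1..n}. A (idx \<sigma> k)) = 0" using k(1) by (intro prod_zero) auto
      then show "summand \<sigma> = 0" by (simp add: summand_def)
    qed
  qed
  also have "\<dots> = (\<Sum>M\<in>MM. summand (\<Phi> M))"
    by (rule sum.reindex_bij_betw[OF \<open>bij_betw \<Phi> MM G\<close>, symmetric])
  also have "\<dots> = (\<Prod>i\<in>{2..m}. of_int (s i)) * (\<Sum>M\<in>MM. \<Prod>e\<in>M. w e)"
    using summand_\<Phi> by (simp add: sum_distrib_left)
  finally show ?thesis .
qed

section \<open>Tilings, height functions and flips\<close>

text \<open>Every edge lies on exactly one loop of each type \<open>\<xi>\<close>; \<open>base d \<xi> e\<close> is the starting point of
  that loop, so that a tiling is a set of edges on which all the maps \<open>base d \<xi>\<close> are bijections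
  onto the lattice.\<close>

definition base :: "nat \<Rightarrow> (nat \<Rightarrow> nat) \<Rightarrow> edge \<Rightarrow> vertex" where
  "base d \<xi> e = (THE x. x \<in> lattice_vertices d \<and> e \<in> loop_edges d (rooted_loop_of d x \<xi>))"

lemma loop_edges_rooted_loop_of:
  "loop_edges d (rooted_loop_of d x \<xi>) = {dedge d (x + offset d \<xi> k) (step d \<xi> k) | k. k \<le> d}"
proof -
  have "{rooted_loop_of d x \<xi> ! k, rooted_loop_of d x \<xi> ! Suc k} =
      dedge d (x + offset d \<xi> k) (step d \<xi> k)" if "k \<le> d" for k
    using that by (simp add: rooted_loop_of_nth dedge_def offset_Suc add.assoc)
  then show ?thesis unfolding loop_edges_altdef by (metis (no_types, lifting))
qed

lemma dedge_lattice:
  "x \<in> lattice_vertices d \<Longrightarrow> i \<in> dirs d \<Longrightarrow> dedge d x i \<in> lattice_edges d"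
  unfolding lattice_edges_iff by blast

lemma lattice_edges_step:
  assumes "e \<in> lattice_edges d" "\<xi> permutes {1..d}"
  obtains x k where "x \<in> lattice_vertices d" "k \<le> d" "e = dedge d x (step d \<xi> k)"
  using assms step_surj[OF assms(2)] unfolding lattice_edges_iff by metis

text \<open>Turns the \<open>\<exists>!\<close> in the definition of a tiling into bijectivity of
  \<open>base\<close>.\<close>

lemma bij_betw_iff_unique:
  "bij_betw f A B \<longleftrightarrow> f ` A \<subseteq> B \<and> (\<forall>y\<in>B. \<exists>!x. x \<in> A \<and> f x = y)"
proof
  assume "bij_betw f A B"
  then show "f ` A \<subseteq> B \<and> (\<forall>y\<in>B. \<exists>!x. x \<in> A \<and> f x = y)"
    unfolding bij_betw_def inj_on_def by (metis imageE order_refl)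
next
  assume *: "f ` A \<subseteq> B \<and> (\<forall>y\<in>B. \<exists>!x. x \<in> A \<and> f x = y)"
  then have "inj_on f A" by (intro inj_onI) (metis image_subset_iff)
  moreover have "f ` A = B" using * by (intro equalityI subsetI) (blast, metis imageI)
  ultimately show "bij_betw f A B" by (simp add: bij_betw_def)
qed

text \<open>A path is a start and a list of directions, so that exchanging increments is an
  operation on lists.\<close>

fun crossings :: "nat \<Rightarrow> edge set \<Rightarrow> vertex \<Rightarrow> nat list \<Rightarrow> nat" where
  "crossings d Y x [] = 0"
| "crossings d Y x (i # L) = (if dedge d x i \<in> Y then 1 else 0) + crossings d Y (x + gvec d i) L"

lemma crossings_append:
  "crossings d Y x (L @ M) = crossings d Y x L + crossings d Y (x + gsum d L) M"
  by (induction L arbitrary: x) (simp_all add: add.assoc)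

lemma crossings_conv_sum:
  "crossings d Y x L =
     (\<Sum>k<length L. if dedge d (x + gsum d (take k L)) (L ! k) \<in> Y then 1 else 0)"
  by (induction L arbitrary: x) (simp_all add: sum.lessThan_Suc_shift add.assoc del: sum.lessThan_Suc)

definition height :: "nat \<Rightarrow> edge set \<Rightarrow> (vertex \<Rightarrow> int) \<Rightarrow> bool" where
  "height d Y f \<longleftrightarrow> (\<forall>x\<in>lattice_vertices d. \<forall>i\<in>dirs d.
     f (x + gvec d i) = f x + 1 - (if dedge d x i \<in> Y then int (d + 1) else 0))"

lemma heightD:
  "height d Y f \<Longrightarrow> x \<in> lattice_vertices d \<Longrightarrow> i \<in> dirs d \<Longrightarrow>
     f (x + gvec d i) = f x + 1 - (if dedge d x i \<in> Y then int (d + 1) else 0)"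
  unfolding height_def by blast

definition out_star :: "nat \<Rightarrow> vertex \<Rightarrow> edge set" where
  "out_star d x = dedge d x ` dirs d"

definition in_star :: "nat \<Rightarrow> vertex \<Rightarrow> edge set" where
  "in_star d x = (\<lambda>i. dedge d (x - gvec d i) i) ` dirs d"

text \<open>Used when all edges leaving \<open>x\<close> lie in \<open>Y\<close>. One direction of
  the move suffices: of two tilings, the one whose height is larger somewhere is lowered.\<close>

definition flip :: "nat \<Rightarrow> vertex \<Rightarrow> edge set \<Rightarrow> edge set" where
  "flip d x Y = (Y - out_star d x) \<union> in_star d x"

text \<open>Passing to the next position on a closed loop, with wrap-around from \<open>d\<close> to
  0; beyond \<open>d\<close> everything is fixed, so that \<open>permutes\<close> applies.\<close>

definition cyc :: "nat \<Rightarrow> nat \<Rightarrow> nat" where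
  "cyc d k = (if k < d then Suc k else if k = d then 0 else k)"

lemma cyc_permutes: "cyc d permutes {..d}"
proof (rule bij_imp_permutes)
  have "inj_on (cyc d) {..d}" by (rule inj_onI) (auto simp: cyc_def split: if_splits)
  moreover have "cyc d ` {..d} \<subseteq> {..d}" by (auto simp: cyc_def)
  ultimately show "bij_betw (cyc d) {..d} {..d}" by (simp add: bij_betw_def endo_inj_surj)
qed (auto simp: cyc_def)

lemma cyc_le: "k \<le> d \<Longrightarrow> cyc d k \<le> d" by (auto simp: cyc_def)

lemma offset_cyc: "\<xi> permutes {1..d} \<Longrightarrow> k \<le> d \<Longrightarrow> offset d \<xi> (Suc k) = offset d \<xi> (cyc d k)"
  using offset_full[of \<xi> d] by (cases "k = d") (auto simp: cyc_def)

text \<open>The point reflection at \<open>x\<close> matches the edges leaving \<open>x\<close> with those entering \<open>x\<close>.\<close>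

definition flip_edge :: "nat \<Rightarrow> vertex \<Rightarrow> edge \<Rightarrow> edge" where
  "flip_edge d x e = (if e \<in> out_star d x then (\<lambda>v. x + x - v) ` e else e)"

context
  fixes d :: nat
  assumes d2: "2 \<le> d"
begin

text \<open>A loop of type \<open>\<xi>\<close> uses every direction once, direction
  \<open>step d \<xi> k\<close> at position \<open>k\<close>. The edge thus determines its position
  and then the start, which is why exactly one loop per type passes through it.\<close>

lemma dedge_mem_loop_edges_iff:
  assumes "\<xi> permutes {1..d}" "k \<le> d"
  shows "dedge d y (step d \<xi> k) \<in> loop_edges d (rooted_loop_of d x \<xi>) \<longleftrightarrow> x = y - offset d \<xi> k"
  unfolding loop_edges_rooted_loop_of
proof -
  have "dedge d y (step d \<xi> k) = dedge d (x + offset d \<xi> l) (step d \<xi> l) \<longleftrightarrow>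
      y = x + offset d \<xi> l \<and> k = l" if "l \<le> d" for l
    using dedge_eq_iff[OF d2] step_mem[OF assms(1)] step_inj[OF assms(1)] assms(2) that by metis
  then show "dedge d y (step d \<xi> k) \<in> {dedge d (x + offset d \<xi> k) (step d \<xi> k) | k. k \<le> d} \<longleftrightarrow>
      x = y - offset d \<xi> k"
    using assms(2) by (auto simp: eq_diff_eq)
qed

lemma base_dedge:
  assumes "\<xi> permutes {1..d}" "k \<le> d" "y \<in> lattice_vertices d"
  shows "base d \<xi> (dedge d y (step d \<xi> k)) = y - offset d \<xi> k"
  unfolding base_def dedge_mem_loop_edges_iff[OF assms(1,2)]
  using lattice_diff[OF assms(3) offset_lattice[OF assms(1)], of k] assms(2)
  by (intro the_equality) auto

lemma base_lattice:
  assumes "\<xi> permutes {1..d}" "e \<in> lattice_edges d"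
  shows "base d \<xi> e \<in> lattice_vertices d"
proof -
  obtain x k where "x \<in> lattice_vertices d" "k \<le> d" "e = dedge d x (step d \<xi> k)"
    using lattice_edges_step[OF assms(2,1)] .
  then show ?thesis using assms by (simp add: base_dedge lattice_diff offset_lattice)
qed

lemma mem_loop_edges_iff_base:
  assumes "\<xi> permutes {1..d}" "e \<in> lattice_edges d"
  shows "e \<in> loop_edges d (rooted_loop_of d x \<xi>) \<longleftrightarrow> base d \<xi> e = x"
proof -
  obtain y k where "y \<in> lattice_vertices d" "k \<le> d" "e = dedge d y (step d \<xi> k)"
    using lattice_edges_step[OF assms(2,1)] .
  then show ?thesis using assms by (auto simp: base_dedge dedge_mem_loop_edges_iff)
qed

text \<open>By \<open>rooted_loop_rotate\<close> the tiling condition can be tested on loops in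
  normal form; for fixed \<open>\<xi>\<close> these are indexed by their starting points, and
  meeting each exactly once is bijectivity of \<open>base d \<xi>\<close>.\<close>

lemma tilings_iff:
  "Y \<in> tilings d \<longleftrightarrow>
     Y \<subseteq> lattice_edges d \<and> (\<forall>\<xi>. \<xi> permutes {1..d} \<longrightarrow> bij_betw (base d \<xi>) Y (lattice_vertices d))"
proof (cases "Y \<subseteq> lattice_edges d")
  case True
  have "Y \<in> tilings d \<longleftrightarrow> (\<forall>s\<in>rooted_loops d. \<exists>!e. e \<in> Y \<and> e \<in> loop_edges d s)"
    unfolding tilings_def using True by blast
  also have "\<dots> \<longleftrightarrow> (\<forall>\<xi>. \<xi> permutes {1..d} \<longrightarrow>
      (\<forall>x\<in>lattice_vertices d. \<exists>!e. e \<in> Y \<and> e \<in> loop_edges d (rooted_loop_of d x \<xi>)))"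
  proof (intro iffI ballI)
    fix s assume *: "\<forall>\<xi>. \<xi> permutes {1..d} \<longrightarrow>
      (\<forall>x\<in>lattice_vertices d. \<exists>!e. e \<in> Y \<and> e \<in> loop_edges d (rooted_loop_of d x \<xi>))"
      and s: "s \<in> rooted_loops d"
    obtain x \<xi> where x: "x \<in> lattice_vertices d" "\<xi> permutes {1..d}"
      and "(s, rooted_loop_of d x \<xi>) \<in> cyclic_rel d"
      using rooted_loop_rotate[OF s] .
    then have "loop_edges d s = loop_edges d (rooted_loop_of d x \<xi>)"
      using loop_edges_cyclic by blast
    moreover have "\<exists>!e. e \<in> Y \<and> e \<in> loop_edges d (rooted_loop_of d x \<xi>)" using * x by blast
    ultimately show "\<exists>!e. e \<in> Y \<and> e \<in> loop_edges d s" by simp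
  qed (use rooted_loop_of_mem in blast)
  also have "\<dots> \<longleftrightarrow> (\<forall>\<xi>. \<xi> permutes {1..d} \<longrightarrow> bij_betw (base d \<xi>) Y (lattice_vertices d))"
  proof (intro all_cong1 imp_cong refl)
    fix \<xi> assume \<xi>: "\<xi> permutes {1..d}"
    have "(\<exists>!e. e \<in> Y \<and> e \<in> loop_edges d (rooted_loop_of d x \<xi>)) \<longleftrightarrow> (\<exists>!e. e \<in> Y \<and> base d \<xi> e = x)"
      for x
    proof -
      have "e \<in> Y \<and> e \<in> loop_edges d (rooted_loop_of d x \<xi>) \<longleftrightarrow> e \<in> Y \<and> base d \<xi> e = x" for e
        using mem_loop_edges_iff_base[OF \<xi>, of e x] True by blast
      then show ?thesis by simp
    qed
    moreover have sub: "base d \<xi> ` Y \<subseteq> lattice_vertices d" using base_lattice[OF \<xi>] True by blast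
    ultimately show "(\<forall>x\<in>lattice_vertices d. \<exists>!e. e \<in> Y \<and> e \<in> loop_edges d (rooted_loop_of d x \<xi>)) \<longleftrightarrow>
        bij_betw (base d \<xi>) Y (lattice_vertices d)"
      unfolding bij_betw_iff_unique by (simp only: sub simp_thms)
  qed
  finally show ?thesis using True by blast
qed (auto simp: tilings_def)

lemma tiling_subset: "Y \<in> tilings d \<Longrightarrow> Y \<subseteq> lattice_edges d"
  and tiling_bij: "Y \<in> tilings d \<Longrightarrow> \<xi> permutes {1..d} \<Longrightarrow> bij_betw (base d \<xi>) Y (lattice_vertices d)"
  unfolding tilings_iff by blast+

section \<open>Numbers of tiling edges along paths\<close>

lemma gsum_full:
  assumes "distinct L" "set L = dirs d"
  shows "gsum d L = 0"
  using sum_list_distinct_conv_sum_set[OF assms(1), of "gvec d"] assms(2) sum_gvec_all by metis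

text \<open>Any ordering of all directions traces a simplicial loop. Its positions carry different
  directions, hence different edges, so counting positions is counting edges.\<close>

lemma crossings_full:
  assumes Y: "Y \<in> tilings d" and x: "x \<in> lattice_vertices d"
    and L: "distinct L" "set L = dirs d"
  shows "crossings d Y x L = 1"
proof -
  have len: "length L = d + 1" using distinct_card[OF L(1)] L(2) by simp
  define p where "p k = x + gsum d (take k L)" for k
  define s where "s = map p [0..<d + 2]"
  have p_Suc: "p (Suc k) = p k + gvec d (L ! k)" if "k \<le> d" for k
    using that len by (simp add: p_def take_Suc_conv_app_nth add.assoc)
  have s_nth: "s ! k = p k" if "k \<le> d + 1" for k using that by (simp add: s_def del: upt_Suc)
  define \<zeta> where "\<zeta> k = (if k \<in> dirs d then L ! (k - 1) else k)" for k
  have "bij_betw ((!) L) {..<length L} (set L)" using L(1) by (intro bij_betw_nth) auto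
  moreover have "bij_betw (\<lambda>k. k - 1) (dirs d) {..<length L}"
    unfolding len by (rule bij_betw_byWitness[where f' = Suc]) auto
  ultimately have "bij_betw ((!) L \<circ> (\<lambda>k. k - 1)) (dirs d) (dirs d)"
    unfolding L(2) by (intro bij_betw_trans)
  then have "bij_betw \<zeta> (dirs d) (dirs d)"
    by (rule iffD1[OF bij_betw_cong, rotated]) (auto simp: \<zeta>_def)
  then have "\<zeta> permutes dirs d" by (rule bij_imp_permutes) (auto simp: \<zeta>_def)
  moreover have "s ! Suc k = s ! k + gvec d (\<zeta> (Suc k))" if "k \<le> d" for k
    using that p_Suc by (simp add: s_nth \<zeta>_def)
  moreover have "p k \<in> lattice_vertices d" for k
    unfolding p_def using L(2) set_take_subset[of k L] by (intro lattice_add x gsum_lattice) auto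
  then have "set s \<subseteq> lattice_vertices d" by (auto simp: s_def)
  moreover have "s ! (d + 1) = s ! 0"
    using gsum_full[OF L] len by (simp add: s_nth p_def)
  ultimately have "s \<in> rooted_loops d" unfolding rooted_loops_altdef by (auto simp: s_def)
  then have "\<exists>!e. e \<in> Y \<and> e \<in> loop_edges d s" using Y by (simp add: tilings_def)
  moreover have "loop_edges d s = (\<lambda>k. dedge d (p k) (L ! k)) ` {..d}"
  proof -
    have "loop_edges d s = (\<lambda>k. {s ! k, s ! Suc k}) ` {..d}" unfolding loop_edges_altdef by blast
    also have "\<dots> = (\<lambda>k. dedge d (p k) (L ! k)) ` {..d}"
      by (intro image_cong refl) (simp add: s_nth dedge_def p_Suc)
    finally show ?thesis .
  qed
  moreover have inj: "k = l" if "k \<le> d" "l \<le> d" "dedge d (p k) (L ! k) = dedge d (p l) (L ! l)" for k l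
  proof -
    have "k < length L" "l < length L" using that len by auto
    then have "L ! k \<in> dirs d" "L ! l \<in> dirs d" using nth_mem L(2) by blast+
    then have "L ! k = L ! l" using that(3) dedge_eq_iff[OF d2] by blast
    then show ?thesis using L(1) \<open>k < length L\<close> \<open>l < length L\<close> by (simp add: nth_eq_iff_index_eq)
  qed
  ultimately obtain k where "k \<le> d" "dedge d (p k) (L ! k) \<in> Y"
    and "\<And>e. e \<in> Y \<Longrightarrow> e \<in> (\<lambda>k. dedge d (p k) (L ! k)) ` {..d} \<Longrightarrow> e = dedge d (p k) (L ! k)"
    by (metis (no_types, lifting) atMost_iff imageE)
  then have k: "dedge d (p k') (L ! k') \<in> Y \<longleftrightarrow> k' = k" if "k' \<le> d" for k'
    using inj[OF that \<open>k \<le> d\<close>] that by blast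
  have "crossings d Y x L = (\<Sum>k'\<in>{..<length L}. if k' = k then 1 else 0)"
    unfolding crossings_conv_sum using k \<open>k \<le> d\<close> len by (intro sum.cong refl) (auto simp: p_def)
  then show ?thesis using \<open>k \<le> d\<close> len by simp
qed

text \<open>Both orders reach the same vertex, and the same list \<open>R\<close> of remaining
  directions completes each to a full loop with crossing number 1; the common part from
  \<open>R\<close> cancels.\<close>

lemma crossings_swap:
  assumes "Y \<in> tilings d" "x \<in> lattice_vertices d" "i \<in> dirs d" "j \<in> dirs d"
  shows "crossings d Y x [i, j] = crossings d Y x [j, i]"
proof (cases "i = j")
  case False
  obtain R where R: "distinct R" "set R = dirs d - {i, j}"
    using finite_distinct_list[of "dirs d - {i, j}"] by auto
  have "insert i (insert j (D - {i, j})) = D" if "i \<in> D" "j \<in> D" for D using that by blast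
  from this[of "dirs d"] have "set ([i, j] @ R) = dirs d" "set ([j, i] @ R) = dirs d"
    using R(2) assms(3,4) by (simp_all only: set_append list.set Un_insert_left Un_empty_left insert_commute)
  then have "crossings d Y x ([i, j] @ R) = 1" "crossings d Y x ([j, i] @ R) = 1"
    using False R by (intro crossings_full assms; simp)+
  moreover have "gsum d [i, j] = gsum d [j, i]" by (simp add: add.commute)
  ultimately show ?thesis unfolding crossings_append by (metis add_right_cancel)
qed simp

text \<open>Adjacent swaps carry \<open>i\<close> past \<open>A\<close> one letter at a
  time.\<close>

lemma crossings_move:
  assumes "Y \<in> tilings d" "x \<in> lattice_vertices d" "set A \<subseteq> dirs d" "i \<in> dirs d"
  shows "crossings d Y x (A @ i # B) = crossings d Y x (i # A @ B)"
  using assms(2,3)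
proof (induction A arbitrary: x)
  case (Cons a A)
  have "crossings d Y x ((a # A) @ i # B) = crossings d Y x [a] + crossings d Y (x + gvec d a) (A @ i # B)"
    by simp
  also have "\<dots> = crossings d Y x [a] + crossings d Y (x + gvec d a) (i # A @ B)"
    using Cons.IH[of "x + gvec d a"] Cons.prems lattice_add[OF _ gvec_lattice, of x d a] by simp
  also have "\<dots> = crossings d Y x ([a, i] @ A @ B)" by simp
  also have "\<dots> = crossings d Y x ([i, a] @ A @ B)"
    unfolding crossings_append using crossings_swap[OF assms(1) Cons.prems(1) assms(4), of a] Cons.prems
    by (simp add: ac_simps)
  finally show ?case by simp
qed simp

text \<open>Each letter of \<open>L\<close> in turn is pulled to the front of
  \<open>L'\<close>.\<close>

lemma crossings_count_cong:
  assumes "Y \<in> tilings d" "x \<in> lattice_vertices d" "set L \<subseteq> dirs d" "set L' \<subseteq> dirs d"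
    "\<And>i. count_list L i = count_list L' i"
  shows "crossings d Y x L = crossings d Y x L'"
  using assms(2-)
proof (induction L arbitrary: L' x)
  case Nil
  have "i \<notin> set L'" for i using Nil.prems(4)[of i] by (simp add: count_list_0_iff)
  then have "L' = []" by (metis set_empty ex_in_conv)
  then show ?case by simp
next
  case (Cons i L)
  have "count_list L' i \<noteq> 0" using Cons.prems(4)[of i, symmetric] by simp
  then have "i \<in> set L'" by (metis count_notin)
  then obtain A B where L': "L' = A @ i # B" by (meson split_list)
  have "count_list L k = count_list (A @ B) k" for k
    using Cons.prems(4)[of k] unfolding L' by (auto split: if_splits)
  then have "crossings d Y (x + gvec d i) L = crossings d Y (x + gvec d i) (A @ B)"
    using Cons.prems L' by (intro Cons.IH) (auto intro!: lattice_add gvec_lattice)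
  then show ?case unfolding L' using Cons.prems L' assms(1)
    by (subst crossings_move) auto
qed

lemma crossings_loops:
  assumes "Y \<in> tilings d" "x \<in> lattice_vertices d"
  shows "crossings d Y x (concat (replicate a [1..<d + 2])) = a"
proof (induction a)
  case (Suc a)
  have F: "set [1..<d + 2] = dirs d" by auto
  have "crossings d Y x [1..<d + 2] = 1" using F by (intro crossings_full assms) simp_all
  moreover have "gsum d [1..<d + 2] = 0" using F by (intro gsum_full) simp_all
  ultimately show ?case using Suc by (simp add: crossings_append del: upt_Suc)
qed simp

text \<open>Equal end points force all multiplicities to differ by one common number
  \<open>a\<close>, so \<open>L\<close> is a rearrangement of \<open>L'\<close> followed by
  \<open>a\<close> full loops. Each loop adds \<open>d + 1\<close> to the length and 1 to the
  crossings, which cancels.\<close>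

lemma crossings_endpoint_aux:
  assumes Y: "Y \<in> tilings d" and x: "x \<in> lattice_vertices d"
    and L: "set L \<subseteq> dirs d" "set L' \<subseteq> dirs d" "gsum d L = gsum d L'"
    and le: "length L' \<le> length L"
  shows "int (length L) - int (d + 1) * int (crossings d Y x L) =
    int (length L') - int (d + 1) * int (crossings d Y x L')"
proof -
  have diff: "(real (count_list L i) - real (count_list L' i)) * real (d + 1) =
      real (length L) - real (length L')" if "i \<in> dirs d" for i
    using gsum_apply[OF L(1) that] gsum_apply[OF L(2) that] L(3) by (simp add: field_simps)
  \<comment> \<open>As \<open>L\<close> is at least as long as \<open>L'\<close>, this subtraction
    of naturals is not truncated.\<close>
  define a where "a = count_list L 1 - count_list L' 1"
  have "0 \<le> (real (count_list L 1) - real (count_list L' 1)) * real (d + 1)"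
    using diff[of 1] le by simp
  then have a: "real a = real (count_list L 1) - real (count_list L' 1)"
    unfolding a_def by (simp add: zero_le_mult_iff)
  have len: "length L = length L' + a * (d + 1)"
  proof -
    have "real (length L) = real (length L' + a * (d + 1))"
      using diff[of 1] unfolding of_nat_add of_nat_mult a by simp
    then show ?thesis by (simp only: of_nat_eq_iff)
  qed
  have count: "count_list L i = count_list L' i + a" if "i \<in> dirs d" for i
  proof -
    have "(real (count_list L i) - real (count_list L' i)) * real (d + 1) = real a * real (d + 1)"
      using diff[OF that] diff[of 1] a by simp
    then have "real (count_list L i) = real (count_list L' i + a)" by simp
    then show ?thesis by (simp only: of_nat_eq_iff)
  qed
  let ?F = "concat (replicate a [1..<d + 2])"
  have "count_list (replicate a F) b = (if b = F then a else 0)" for a and F b :: "nat list"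
    by (induction a) auto
  have distinct: "count_list xs i = (if i \<in> set xs then 1 else 0)" if "distinct xs" for xs and i :: nat
    using that by (induction xs) auto
  have F: "count_list ?F i = (if i \<in> dirs d then a else 0)" for i
    by (induction a) (auto simp: distinct simp del: upt_Suc)
  have "crossings d Y x L = crossings d Y x (L' @ ?F)"
  proof (rule crossings_count_cong[OF Y x])
    show "count_list L i = count_list (L' @ ?F) i" for i
      using count[of i] F[of i] count_notin[of i L] count_notin[of i L'] L by fastforce
  qed (use L in \<open>auto simp del: upt_Suc\<close>)
  also have "\<dots> = crossings d Y x L' + a"
    unfolding crossings_append using L by (simp only: crossings_loops Y lattice_add x gsum_lattice)
  finally show ?thesis unfolding len by (simp add: algebra_simps)
qed

lemma crossings_endpoint:
  assumes "Y \<in> tilings d" "x \<in> lattice_vertices d"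
    and "set L \<subseteq> dirs d" "set L' \<subseteq> dirs d" "gsum d L = gsum d L'"
  shows "int (length L) - int (d + 1) * int (crossings d Y x L) =
    int (length L') - int (d + 1) * int (crossings d Y x L')"
  using crossings_endpoint_aux[OF assms] crossings_endpoint_aux[OF assms(1,2,4,3) assms(5)[symmetric]]
  by (metis nle_le)

section \<open>Height functions\<close>

lemma height_exists:
  assumes "Y \<in> tilings d"
  obtains f where "height d Y f"
proof -
  define h where "h L = int (length L) - int (d + 1) * int (crossings d Y 0 L)" for L
  \<comment> \<open>The height is read off any path from the origin;
    \<open>crossings_endpoint\<close> makes the chosen path immaterial.\<close>
  define f where "f x = h (SOME L. set L \<subseteq> dirs d \<and> x = gsum d L)" for x
  have f: "f (gsum d L) = h L" if "set L \<subseteq> dirs d" for L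
  proof -
    let ?L = "SOME M. set M \<subseteq> dirs d \<and> gsum d L = gsum d M"
    have "set ?L \<subseteq> dirs d \<and> gsum d L = gsum d ?L" by (rule someI[of _ L]) (use that in simp)
    then show ?thesis unfolding f_def h_def
      by (intro crossings_endpoint assms zero_lattice that) simp_all
  qed
  have "height d Y f" unfolding height_def
  proof (intro ballI)
    fix x i assume x: "x \<in> lattice_vertices d" and i: "i \<in> dirs d"
    obtain L where L: "set L \<subseteq> dirs d" "x = gsum d L" using lattice_generated[OF x] .
    have "f (x + gvec d i) = h (L @ [i])" using f[of "L @ [i]"] L i by simp
    also have "\<dots> = h L + 1 - (if dedge d x i \<in> Y then int (d + 1) else 0)"
      unfolding h_def by (simp add: crossings_append L(2) algebra_simps)
    also have "h L = f x" using f L by simp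
    finally show "f (x + gvec d i) = f x + 1 - (if dedge d x i \<in> Y then int (d + 1) else 0)" .
  qed
  then show thesis using that by blast
qed

lemma height_diff_dvd:
  assumes "height d Y f" "height d Y' f'" "x \<in> lattice_vertices d" "y \<in> lattice_vertices d"
  shows "int (d + 1) dvd (f y - f' y) - (f x - f' x)"
proof -
  have *: "int (d + 1) dvd (f (x + gsum d L) - f' (x + gsum d L)) - (f x - f' x)"
    if "set L \<subseteq> dirs d" "x \<in> lattice_vertices d" for L x
    using that
  proof (induction L arbitrary: x)
    case (Cons i L)
    let ?D = "\<lambda>x. f x - f' x"
    have "int (d + 1) dvd ?D (x + gvec d i + gsum d L) - ?D (x + gvec d i)"
      using Cons.prems lattice_add[OF _ gvec_lattice, of x d i] by (intro Cons.IH) simp_all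
    moreover have "int (d + 1) dvd ?D (x + gvec d i) - ?D x"
      using heightD[OF assms(1), of x i] heightD[OF assms(2), of x i] Cons.prems by simp
    ultimately have "int (d + 1) dvd
        (?D (x + gvec d i + gsum d L) - ?D (x + gvec d i)) + (?D (x + gvec d i) - ?D x)"
      by (rule dvd_add)
    also have "\<dots> = ?D (x + gvec d i + gsum d L) - ?D x" by simp
    finally show ?case by (simp add: add.assoc)
  qed simp
  obtain L where "set L \<subseteq> dirs d" "y - x = gsum d L"
    using lattice_generated[OF lattice_diff[OF assms(4,3)]] .
  then show ?thesis using *[of L x] assms(3) by (metis add_diff_cancel_left' diff_add_cancel add.commute)
qed

section \<open>Flips and their effect on loops and heights\<close>

lemma base_in_edge:
  assumes "\<xi> permutes {1..d}" "k \<le> d" "x \<in> lattice_vertices d"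
  shows "base d \<xi> (dedge d (x - gvec d (step d \<xi> k)) (step d \<xi> k)) =
    base d \<xi> (dedge d x (step d \<xi> (cyc d k)))"
proof -
  \<comment> \<open>The edge entering \<open>x\<close> at position \<open>k\<close> and the edge
    leaving \<open>x\<close> at the next position are consecutive on one loop of type
    \<open>\<xi>\<close>; \<open>offset_cyc\<close> absorbs the wrap-around at the last
    position.\<close>
  have "x - gvec d (step d \<xi> k) - offset d \<xi> k = x - offset d \<xi> (Suc k)"
    by (simp add: offset_Suc algebra_simps)
  then show ?thesis
    using base_dedge[OF assms(1,2), of "x - gvec d (step d \<xi> k)"] base_dedge[OF assms(1) _ assms(3)]
      lattice_diff[OF assms(3) gvec_lattice[OF step_mem[OF assms(1,2)]]]
      offset_cyc[OF assms(1,2)] cyc_le[OF assms(2)] by metis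
qed

lemma dirs_step_image: "\<xi> permutes {1..d} \<Longrightarrow> dirs d = step d \<xi> ` {..d}"
  using bij_betw_imp_surj_on[OF bij_step] by metis

lemma out_star_lattice: "x \<in> lattice_vertices d \<Longrightarrow> out_star d x \<subseteq> lattice_edges d"
  unfolding out_star_def by (auto intro!: dedge_lattice)

lemma in_star_lattice: "x \<in> lattice_vertices d \<Longrightarrow> in_star d x \<subseteq> lattice_edges d"
  unfolding in_star_def by (auto intro!: dedge_lattice lattice_diff gvec_lattice)

text \<open>Each loop of type \<open>\<xi>\<close> through \<open>x\<close> enters and leaves
  \<open>x\<close> once, so the two stars meet the same loops, each exactly once.\<close>

lemma base_in_star:
  assumes "\<xi> permutes {1..d}" "x \<in> lattice_vertices d"
  shows "bij_betw (base d \<xi>) (in_star d x) (base d \<xi> ` out_star d x)"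
proof -
  have out: "base d \<xi> (dedge d x (step d \<xi> k)) = x - offset d \<xi> k" if "k \<le> d" for k
    using assms that by (simp add: base_dedge)
  have "base d \<xi> ` in_star d x = (\<lambda>k. base d \<xi> (dedge d x (step d \<xi> (cyc d k)))) ` {..d}"
    unfolding in_star_def dirs_step_image[OF assms(1)] image_image
    by (intro image_cong refl base_in_edge assms) auto
  also have "\<dots> = (\<lambda>k. base d \<xi> (dedge d x (step d \<xi> k))) ` cyc d ` {..d}"
    by (simp only: image_image)
  also have "\<dots> = base d \<xi> ` out_star d x"
    unfolding out_star_def dirs_step_image[OF assms(1)] image_image
      permutes_image[OF cyc_permutes] ..
  finally have im: "base d \<xi> ` in_star d x = base d \<xi> ` out_star d x" .
  have "k = l" if "k \<le> d" "l \<le> d"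
    "base d \<xi> (dedge d (x - gvec d (step d \<xi> k)) (step d \<xi> k)) =
     base d \<xi> (dedge d (x - gvec d (step d \<xi> l)) (step d \<xi> l))" for k l
  proof -
    have "offset d \<xi> (cyc d k) = offset d \<xi> (cyc d l)"
      using that assms by (simp add: base_in_edge out cyc_le)
    then have "cyc d k = cyc d l" using offset_inj[OF assms(1)] cyc_le that by blast
    then show ?thesis using permutes_inj[OF cyc_permutes] by (simp add: inj_eq)
  qed
  then have "inj_on (base d \<xi>) (in_star d x)"
    unfolding in_star_def dirs_step_image[OF assms(1)] inj_on_def by auto
  then show ?thesis using im by (simp add: bij_betw_def)
qed

lemma in_out_star_disjoint: "in_star d x \<inter> out_star d x = {}"
  unfolding in_star_def out_star_def using gvec_nonzero[OF d2] by (auto simp: dedge_eq_iff[OF d2])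

text \<open>An entering edge in \<open>Y\<close> would share its loop of type \<open>id\<close> with
  a leaving edge, also in \<open>Y\<close>; this loop would be met twice.\<close>

lemma in_star_disjoint_tiling:
  assumes "Y \<in> tilings d" "x \<in> lattice_vertices d" "out_star d x \<subseteq> Y"
  shows "in_star d x \<inter> Y = {}"
proof (rule ccontr)
  assume "in_star d x \<inter> Y \<noteq> {}"
  then obtain e where e: "e \<in> in_star d x" "e \<in> Y" by blast
  then obtain e' where "e' \<in> out_star d x" "base d id e = base d id e'"
    using bij_betwE[OF base_in_star[OF permutes_id assms(2)]] by blast
  then have "e' = e" using e(2) assms(3) bij_betw_imp_inj_on[OF tiling_bij[OF assms(1) permutes_id]]
    by (auto dest: inj_onD)
  then show False using e(1) \<open>e' \<in> out_star d x\<close> in_out_star_disjoint by blast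
qed

text \<open>For every type, the removed and the inserted edges have the same image under
  \<open>base d \<xi>\<close>.\<close>

lemma flip_tiling:
  assumes "Y \<in> tilings d" "x \<in> lattice_vertices d" "out_star d x \<subseteq> Y"
  shows "flip d x Y \<in> tilings d"
  unfolding tilings_iff
proof (intro conjI allI impI)
  show "flip d x Y \<subseteq> lattice_edges d"
    using tiling_subset[OF assms(1)] in_star_lattice[OF assms(2)] by (auto simp: flip_def)
  fix \<xi> assume \<xi>: "\<xi> permutes {1..d}"
  let ?B = "base d \<xi> ` out_star d x"
  have bij: "bij_betw (base d \<xi>) Y (lattice_vertices d)" using assms(1) \<xi> by (rule tiling_bij)
  then have "base d \<xi> ` (Y - out_star d x) = lattice_vertices d - ?B"
    using assms(3) inj_on_image_set_diff[of "base d \<xi>" Y Y "out_star d x"]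
    by (auto simp: bij_betw_def)
  then have "bij_betw (base d \<xi>) (Y - out_star d x) (lattice_vertices d - ?B)"
    using bij by (auto simp: bij_betw_def intro: inj_on_subset)
  then have "bij_betw (base d \<xi>) (flip d x Y) ((lattice_vertices d - ?B) \<union> ?B)"
    unfolding flip_def by (rule bij_betw_combine[OF _ base_in_star[OF \<xi> assms(2)]]) blast
  moreover have "(lattice_vertices d - ?B) \<union> ?B = lattice_vertices d"
    using bij assms(3) by (auto simp: bij_betw_def)
  ultimately show "bij_betw (base d \<xi>) (flip d x Y) (lattice_vertices d)" by simp
qed

text \<open>Lowering the value at \<open>x\<close> by \<open>d + 1\<close> turns the drops along
  leaving edges into rises and the rises along entering edges into drops, which is the exchange of
  the two stars.\<close>

lemma flip_height:
  assumes "Y \<in> tilings d" "x \<in> lattice_vertices d" "out_star d x \<subseteq> Y" "height d Y f"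
  shows "height d (flip d x Y) (f(x := f x - int (d + 1)))"
  unfolding height_def
proof (intro ballI)
  fix y i assume y: "y \<in> lattice_vertices d" and i: "i \<in> dirs d"
  have out: "dedge d y i \<in> out_star d x \<longleftrightarrow> y = x"
    using i dedge_eq_iff[OF d2] by (auto simp: out_star_def)
  have "in": "dedge d y i \<in> in_star d x \<longleftrightarrow> y + gvec d i = x"
  proof
    assume "dedge d y i \<in> in_star d x"
    then obtain j where "j \<in> dirs d" "dedge d y i = dedge d (x - gvec d j) j"
      unfolding in_star_def by blast
    then show "y + gvec d i = x" using dedge_eq_iff[OF d2 i] by simp
  next
    assume "y + gvec d i = x"
    then have "y = x - gvec d i" by (simp add: eq_diff_eq)
    then show "dedge d y i \<in> in_star d x" using i unfolding in_star_def by blast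
  qed
  have "y + gvec d i \<noteq> y" using gvec_nonzero[OF d2 i] by simp
  moreover have "dedge d y i \<notin> Y" if "y + gvec d i = x"
    using that "in" in_star_disjoint_tiling[OF assms(1-3)] by blast
  ultimately show "(f(x := f x - int (d + 1))) (y + gvec d i) = (f(x := f x - int (d + 1))) y + 1
      - (if dedge d y i \<in> flip d x Y then int (d + 1) else 0)"
    using heightD[OF assms(4) y i] out "in" assms(3) by (auto simp: flip_def)
qed

section \<open>Connectedness of the tilings of a region under flips\<close>

lemma star_edges_at:
  assumes "x \<in> R" "x \<in> lattice_vertices d"
  shows "out_star d x \<subseteq> edges_at d R" "in_star d x \<subseteq> edges_at d R"
  using out_star_lattice[OF assms(2)] in_star_lattice[OF assms(2)] assms(1)
  by (auto simp: edges_at_def out_star_def in_star_def dedge_def)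

lemma flip_tilings_of:
  assumes "Y \<in> tilings_of d R T" "x \<in> R" "x \<in> lattice_vertices d" "out_star d x \<subseteq> Y"
  shows "flip d x Y \<in> tilings_of d R T"
  using assms flip_tiling[of Y x] star_edges_at[OF assms(2,3)]
  by (auto simp: tilings_of_def flip_def)

text \<open>A vertex where \<open>f > f'\<close> and \<open>f\<close> is largest is a local maximum of \<open>f\<close>: going up from it would
  lead to a vertex where still \<open>f > f'\<close>.\<close>

lemma exists_flippable:
  assumes f: "height d Y f" "height d Y' f'" and R: "finite R" "R \<subseteq> lattice_vertices d"
    and eq: "\<And>y. y \<in> lattice_vertices d - R \<Longrightarrow> f y = f' y" and "\<exists>x\<in>R. f' x < f x"
  obtains x where "x \<in> R" "f' x < f x" "out_star d x \<subseteq> Y"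
proof -
  let ?D = "{x \<in> R. f' x < f x}"
  have "finite (f ` ?D)" "f ` ?D \<noteq> {}" using R assms(6) by auto
  then have "Max (f ` ?D) \<in> f ` ?D" by (rule Max_in)
  then obtain x where x: "x \<in> R" "f' x < f x" and "f x = Max (f ` ?D)" by auto
  then have max: "f y \<le> f x" if "y \<in> ?D" for y using R(1) that by auto
  have "dedge d x i \<in> Y" if i: "i \<in> dirs d" for i
  proof (rule ccontr)
    assume "dedge d x i \<notin> Y"
    let ?y = "x + gvec d i"
    have xV: "x \<in> lattice_vertices d" using x R by blast
    have up: "f ?y = f x + 1" using heightD[OF f(1) xV i] \<open>dedge d x i \<notin> Y\<close> by simp
    then have "?y \<notin> ?D" using max by fastforce
    then have "f ?y \<le> f' ?y"
      using eq[of ?y] lattice_add[OF xV gvec_lattice[OF i]] by force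
    moreover have "f' ?y \<le> f' x + 1" using heightD[OF f(2) xV i] by (simp split: if_splits)
    ultimately show False using up x by simp
  qed
  then have "out_star d x \<subseteq> Y" unfolding out_star_def by blast
  then show thesis using that x by blast
qed

text \<open>A positive multiple of \<open>d + 1\<close> is at least \<open>d + 1\<close>, so the
  lowered value at \<open>x\<close> does not fall below \<open>f' x\<close>, and the difference
  shrinks.\<close>

lemma flip_distance:
  fixes f f' :: "vertex \<Rightarrow> int"
  assumes "finite R" "x \<in> R" "f' x < f x" "int (d + 1) dvd f x - f' x"
  shows "(\<Sum>y\<in>R. nat \<bar>(f(x := f x - int (d + 1))) y - f' y\<bar>) < (\<Sum>y\<in>R. nat \<bar>f y - f' y\<bar>)"
proof (rule sum_strict_mono_ex1)
  have "int (d + 1) \<le> f x - f' x" using assms by (intro zdvd_imp_le) auto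
  then have "nat \<bar>f x - int (d + 1) - f' x\<bar> < nat \<bar>f x - f' x\<bar>" by auto
  then show "\<forall>y\<in>R. nat \<bar>(f(x := f x - int (d + 1))) y - f' y\<bar> \<le> nat \<bar>f y - f' y\<bar>"
    and "\<exists>y\<in>R. nat \<bar>(f(x := f x - int (d + 1))) y - f' y\<bar> < nat \<bar>f y - f' y\<bar>"
    using assms(2) by auto
qed (use assms in auto)

text \<open>Connectedness is stated through an arbitrary flip-invariant \<open>F\<close>, which lets
  flips be applied to either tiling without recording a chain. The induction is on the total height
  difference over \<open>R\<close>.\<close>

lemma flip_invariant_aux:
  assumes flip: "\<And>Y x. Y \<in> tilings_of d R T \<Longrightarrow> x \<in> R \<Longrightarrow> out_star d x \<subseteq> Y \<Longrightarrow> F (flip d x Y) = F Y"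
    and R: "finite R" "R \<subseteq> lattice_vertices d"
    and "Y \<in> tilings_of d R T" "Y' \<in> tilings_of d R T" "height d Y f" "height d Y' f'"
    and "\<And>y. y \<in> lattice_vertices d - R \<Longrightarrow> f y = f' y"
    and "\<And>y. y \<in> lattice_vertices d \<Longrightarrow> int (d + 1) dvd f y - f' y"
  shows "F Y = F Y'"
  using assms(4-)
proof (induction "\<Sum>y\<in>R. nat \<bar>f y - f' y\<bar>" arbitrary: Y Y' f f' rule: less_induct)
  case less
  have Y: "Y \<in> tilings d" "Y' \<in> tilings d" using less.prems by (auto simp: tilings_of_def)
  consider "\<exists>x\<in>R. f' x < f x" | "\<exists>x\<in>R. f x < f' x" | "\<And>y. y \<in> lattice_vertices d \<Longrightarrow> f y = f' y"
    using less.prems(5) by (metis DiffI linorder_neqE)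
  then show ?case
  proof cases
    case 1
    obtain x where x: "x \<in> R" "f' x < f x" "out_star d x \<subseteq> Y"
      using exists_flippable[OF less.prems(3,4) R less.prems(5) 1] by blast
    have xV: "x \<in> lattice_vertices d" using x R by blast
    have "F (flip d x Y) = F Y'"
    proof (rule less.hyps)
      show "(\<Sum>y\<in>R. nat \<bar>(f(x := f x - int (d + 1))) y - f' y\<bar>) < (\<Sum>y\<in>R. nat \<bar>f y - f' y\<bar>)"
        by (intro flip_distance R(1) x less.prems(6) xV)
      show "height d (flip d x Y) (f(x := f x - int (d + 1)))"
        by (intro flip_height Y x xV less.prems)
      show "flip d x Y \<in> tilings_of d R T" by (intro flip_tilings_of less.prems x xV)
      fix y assume "y \<in> lattice_vertices d"
      then have dvd: "int (d + 1) dvd f y - f' y" by (rule less.prems(6))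
      then have "int (d + 1) dvd f y - f' y - int (d + 1)" by (rule dvd_diff[OF _ dvd_refl])
      moreover have "f y - f' y - int (d + 1) = f y - int (d + 1) - f' y" by simp
      ultimately show "int (d + 1) dvd (f(x := f x - int (d + 1))) y - f' y"
        using dvd by (simp only: fun_upd_apply split: if_split) blast
    qed (use less.prems x in auto)
    then show ?thesis using flip less.prems x by simp
  next
    \<comment> \<open>The mirror image: now \<open>Y'\<close> is the tiling that is flipped.\<close>
    case 2
    have eq': "\<And>y. y \<in> lattice_vertices d - R \<Longrightarrow> f' y = f y" using less.prems(5) by simp
    have dvd': "int (d + 1) dvd f' y - f y" if "y \<in> lattice_vertices d" for y
      using less.prems(6)[OF that] by (metis dvd_diff_commute)
    obtain x where x: "x \<in> R" "f x < f' x" "out_star d x \<subseteq> Y'"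
      using exists_flippable[OF less.prems(4,3) R eq' 2] by blast
    have xV: "x \<in> lattice_vertices d" using x R by blast
    have "F Y = F (flip d x Y')"
    proof (rule less.hyps)
      show "(\<Sum>y\<in>R. nat \<bar>f y - (f'(x := f' x - int (d + 1))) y\<bar>) < (\<Sum>y\<in>R. nat \<bar>f y - f' y\<bar>)"
        using flip_distance[where f = f' and f' = f, OF R(1) x(1,2) dvd'[OF xV]] by (simp only: abs_minus_commute)
      show "height d (flip d x Y') (f'(x := f' x - int (d + 1)))"
        by (intro flip_height Y x xV less.prems)
      show "flip d x Y' \<in> tilings_of d R T" by (intro flip_tilings_of less.prems x xV)
      fix y assume "y \<in> lattice_vertices d"
      then have dvd: "int (d + 1) dvd f y - f' y" by (rule less.prems(6))
      then have "int (d + 1) dvd f y - f' y + int (d + 1)" by (rule dvd_add[OF _ dvd_refl])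
      moreover have "f y - f' y + int (d + 1) = f y - (f' y - int (d + 1))" by simp
      ultimately show "int (d + 1) dvd f y - (f'(x := f' x - int (d + 1))) y"
        using dvd by (simp only: fun_upd_apply split: if_split) blast
    qed (use less.prems x in auto)
    then show ?thesis using flip less.prems x by simp
  next
    case 3
    \<comment> \<open>The drops of a height mark exactly the edges of its tiling, so equal heights
      mean equal tilings.\<close>
    have "e \<in> Y \<longleftrightarrow> e \<in> Y'" if e: "e \<in> lattice_edges d" for e
    proof -
      obtain x i where xi: "x \<in> lattice_vertices d" "i \<in> dirs d" "e = dedge d x i"
        using e unfolding lattice_edges_iff by blast
      then have "f x = f' x" "f (x + gvec d i) = f' (x + gvec d i)"
        by (auto intro!: 3 lattice_add gvec_lattice)
      then show ?thesis
        using heightD[OF less.prems(3) xi(1,2)] heightD[OF less.prems(4) xi(1,2)] xi(3)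
        by (auto split: if_splits)
    qed
    then have "Y = Y'" using tiling_subset[OF Y(1)] tiling_subset[OF Y(2)] by blast
    then show ?thesis by simp
  qed
qed

lemma flip_invariant:
  assumes flip: "\<And>Y x. Y \<in> tilings_of d R T \<Longrightarrow> x \<in> R \<Longrightarrow> out_star d x \<subseteq> Y \<Longrightarrow> F (flip d x Y) = F Y"
    and region: "region d R"
    and Y: "Y \<in> tilings_of d R T" "Y' \<in> tilings_of d R T"
  shows "F Y = F Y'"
proof -
  have R: "finite R" "R \<subseteq> lattice_vertices d" using region by (auto simp: region_def)
  have Yt: "Y \<in> tilings d" "Y' \<in> tilings d" using Y by (auto simp: tilings_of_def)
  obtain f f0 where f: "height d Y f" "height d Y' f0" using height_exists Yt by metis
  \<comment> \<open>The fallback \<open>0\<close> covers an empty complement of \<open>R\<close>: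
    agreement off \<open>R\<close> is then vacuous, and \<open>0\<close> still serves as the lattice
    point for the divisibility.\<close>
  define x0 where "x0 = (if lattice_vertices d - R = {} then 0 else SOME x. x \<in> lattice_vertices d - R)"
  have x0: "x0 \<in> lattice_vertices d" "lattice_vertices d - R \<noteq> {} \<Longrightarrow> x0 \<in> lattice_vertices d - R"
    using some_in_eq[of "lattice_vertices d - R"] zero_lattice by (auto simp: x0_def)
  \<comment> \<open>A height stays a height after adding a constant; this one is normalised to agree
    with \<open>f\<close> at \<open>x0\<close>.\<close>
  define f' where "f' y = f0 y + (f x0 - f0 x0)" for y
  have f': "height d Y' f'" using f(2) by (auto simp: height_def f'_def)
  have same: "f v - f' v = f u - f' u"
    if "u \<in> lattice_vertices d - R" "v \<in> lattice_vertices d - R" "{u, v} \<in> lattice_edges d" for u v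
  proof -
    obtain x i where xi: "x \<in> lattice_vertices d" "i \<in> dirs d" "{u, v} = dedge d x i"
      using \<open>{u, v} \<in> _\<close> unfolding lattice_edges_iff by blast
    \<comment> \<open>Both ends lie off \<open>R\<close>, so the two tilings agree on this edge and
      the difference of the heights is constant along it.\<close>
    have "dedge d x i \<notin> edges_at d R" using that unfolding xi(3)[symmetric] edges_at_def by auto
    then have "dedge d x i \<in> Y \<longleftrightarrow> dedge d x i \<in> Y'" using Y by (auto simp: tilings_of_def)
    then have "f (x + gvec d i) - f' (x + gvec d i) = f x - f' x"
      using heightD[OF f(1) xi(1,2)] heightD[OF f' xi(1,2)] by simp
    then show ?thesis using xi(3) by (auto simp: dedge_def doubleton_eq_iff)
  qed
  have "f y = f' y" if y: "y \<in> lattice_vertices d - R" for y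
  proof -
    have "x0 \<in> lattice_vertices d - R" using x0 y by blast
    then have "(x0, y) \<in> {(u, v). u \<in> lattice_vertices d - R \<and> v \<in> lattice_vertices d - R \<and>
        {u, v} \<in> lattice_edges d}\<^sup>*"
      using region y unfolding region_def connected_in_lattice_def by blast
    then have "f y - f' y = f x0 - f' x0"
      by (induction rule: rtrancl_induct) (auto simp: same)
    then show ?thesis by (simp add: f'_def)
  qed
  moreover have "int (d + 1) dvd f y - f' y" if "y \<in> lattice_vertices d" for y
    using height_diff_dvd[OF f(1) f' x0(1) that] by (simp add: f'_def)
  ultimately show ?thesis using flip_invariant_aux[OF flip R Y f(1) f'] by blast
qed

section \<open>The sign of a tiling\<close>

text \<open>The only edge in direction \<open>d + 1\<close> reveals \<open>x\<close>. Inductively,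
  equal directions before position \<open>k\<close> give equal offsets, and the edge leaving that
  vertex sits at the same position of both loops because offsets are distinct.\<close>

lemma loop_of_inj:
  assumes x: "x \<in> lattice_vertices d" "\<xi> permutes {1..d}"
    and x': "x' \<in> lattice_vertices d" "\<xi>' permutes {1..d}"
    and eq: "loop_of d x \<xi> = loop_of d x' \<xi>'"
  shows "x = x' \<and> \<xi> = \<xi>'"
proof -
  have edges: "loop_edges d (rooted_loop_of d x \<xi>) = loop_edges d (rooted_loop_of d x' \<xi>')"
  proof (rule set_eqI)
    fix e show "e \<in> loop_edges d (rooted_loop_of d x \<xi>) \<longleftrightarrow> e \<in> loop_edges d (rooted_loop_of d x' \<xi>')"
      using traverses_loop_of[OF x, of e] traverses_loop_of[OF x', of e] eq by simp
  qed
  have "dedge d x (step d \<xi>' 0) \<in> loop_edges d (rooted_loop_of d x \<xi>)"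
    using dedge_mem_loop_edges_iff[OF x(2), of 0 x x] by (simp add: step_def)
  then have "x = x'"
    using dedge_mem_loop_edges_iff[OF x'(2), of 0 x x'] edges by simp
  have "step d \<xi> k = step d \<xi>' k" if "k \<le> d" for k
    using that
  proof (induction k rule: less_induct)
    case (less k)
    then have "offset d \<xi> k = offset d \<xi>' k" unfolding offset_def by (intro sum.cong refl) auto
    have "dedge d (x + offset d \<xi> k) (step d \<xi> k) \<in> loop_edges d (rooted_loop_of d x \<xi>')"
      using edges less.prems unfolding \<open>x = x'\<close>[symmetric] loop_edges_rooted_loop_of[of d x \<xi>] by blast
    then obtain k' where k': "k' \<le> d"
      "dedge d (x + offset d \<xi> k) (step d \<xi> k) = dedge d (x + offset d \<xi>' k') (step d \<xi>' k')"
      unfolding loop_edges_rooted_loop_of by blast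
    then have "offset d \<xi>' k = offset d \<xi>' k'" "step d \<xi> k = step d \<xi>' k'"
      using dedge_eq_iff[OF d2 step_mem[OF x(2) less.prems] step_mem[OF x'(2) k'(1)]]
        \<open>offset d \<xi> k = offset d \<xi>' k\<close> by auto
    then show ?case using offset_inj[OF x'(2) less.prems k'(1)] by simp
  qed
  then have "\<xi> k = \<xi>' k" if "k \<in> {1..d}" for k using that by (force simp: step_def)
  then have "\<xi> = \<xi>'" using x(2) x'(2) by (metis ext permutes_not_in)
  then show ?thesis using \<open>x = x'\<close> by simp
qed

lemma exists_permutation:
  assumes "i \<in> {1..d}" "j \<in> {1..d}" "i \<noteq> j"
  obtains \<xi> where "\<xi> permutes {1..d}" "\<xi> 1 = i" "\<xi> 2 = j"
proof -
  \<comment> \<open>\<open>?k\<close> is the element that the swap of 1 and \<open>i\<close> sends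
    to \<open>j\<close>; swapping it with 2 first leaves 1 alone because
    \<open>j \<noteq> i\<close>.\<close>
  let ?k = "transpose 1 i j"
  have "?k \<noteq> 1" "?k \<in> {1..d}" using assms by (auto simp: transpose_def)
  then have "transpose 1 i \<circ> transpose 2 ?k permutes {1..d}"
    using assms d2 by (intro permutes_compose permutes_swap_id) auto
  moreover have "(transpose 1 i \<circ> transpose 2 ?k) 1 = i"
    using \<open>?k \<noteq> 1\<close> by (simp add: transpose_def)
  moreover have "(transpose 1 i \<circ> transpose 2 ?k) 2 = j" by simp
  ultimately show thesis using that by blast
qed

lemma base_dedge_012:
  assumes "\<xi> permutes {1..d}" "y \<in> lattice_vertices d"
  shows "base d \<xi> (dedge d y (d + 1)) = y"
    and "base d \<xi> (dedge d y (\<xi> 1)) = y - gvec d (d + 1)"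
    and "base d \<xi> (dedge d y (\<xi> 2)) = y - (gvec d (d + 1) + gvec d (\<xi> 1))"
  using base_dedge[OF assms(1) _ assms(2), of 0] base_dedge[OF assms(1) _ assms(2), of 1]
    base_dedge[OF assms(1) _ assms(2), of 2] d2
  by (simp_all add: step_def offset_Suc numeral_2_eq_2)

text \<open>Direction \<open>d + 1\<close> always sits at position 0, so the left base is always
  \<open>y\<close>; moving \<open>i\<close> from position 1 to position 2 changes the right base by
  \<open>gvec d j\<close>, which is nonzero.\<close>

lemma base_separates_last:
  assumes y: "y \<in> lattice_vertices d" "y' \<in> lattice_vertices d" and i: "i \<in> {1..d}"
    and eq: "\<And>\<xi>. \<xi> permutes {1..d} \<Longrightarrow> base d \<xi> (dedge d y (d + 1)) = base d \<xi> (dedge d y' i)"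
  shows False
proof -
  have "(if i = 1 then 2 else 1) \<in> {1..d}" "(if i = 1 then 2 else 1) \<noteq> i" using d2 by auto
  then obtain j where j: "j \<in> {1..d}" "j \<noteq> i" by blast
  obtain \<xi> where \<xi>: "\<xi> permutes {1..d}" "\<xi> 1 = i" "\<xi> 2 = j"
    using exists_permutation[OF i j(1)] j(2) by blast
  obtain \<nu> where \<nu>: "\<nu> permutes {1..d}" "\<nu> 1 = j" "\<nu> 2 = i"
    using exists_permutation[OF j(1) i] j(2) by blast
  have "y = y' - gvec d (d + 1)"
    using eq[OF \<xi>(1)] base_dedge_012[OF \<xi>(1) y(1)] base_dedge_012[OF \<xi>(1) y(2)] \<xi> by simp
  moreover have "y = y' - (gvec d (d + 1) + gvec d j)"
    using eq[OF \<nu>(1)] base_dedge_012[OF \<nu>(1) y(1)] base_dedge_012[OF \<nu>(1) y(2)] \<nu> by simp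
  ultimately have "gvec d j = 0" by (metis add_cancel_left_right diff_left_imp_eq)
  then show False using gvec_nonzero[OF d2, of j] j(1) by auto
qed

text \<open>Two distinct directions up to \<open>d\<close>, placed at positions 1 and 2 in both
  orders, would give \<open>y' = y + gvec d i\<close> and \<open>y = y' + gvec d i'\<close>, against
  \<open>gvec_add_nonzero\<close>. So an edge is determined by its loops, and the \<open>THE\<close>
  in \<open>kasteleyn\<close> is meaningful.\<close>

lemma base_separates:
  assumes e: "e \<in> lattice_edges d" "e' \<in> lattice_edges d"
    and eq: "\<And>\<xi>. \<xi> permutes {1..d} \<Longrightarrow> base d \<xi> e = base d \<xi> e'"
  shows "e = e'"
proof -
  obtain y i where y: "y \<in> lattice_vertices d" "i \<in> dirs d" "e = dedge d y i"
    using e(1) unfolding lattice_edges_iff by blast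
  obtain y' i' where y': "y' \<in> lattice_vertices d" "i' \<in> dirs d" "e' = dedge d y' i'"
    using e(2) unfolding lattice_edges_iff by blast
  consider "i = i'" | "i = d + 1" "i' \<in> {1..d}" | "i' = d + 1" "i \<in> {1..d}"
    | "i \<noteq> i'" "i \<in> {1..d}" "i' \<in> {1..d}" using y(2) y'(2) by force
  then show ?thesis
  proof cases
    case 1
    obtain k where k: "k \<le> d" "step d id k = i" using step_surj[OF permutes_id y(2)] .
    have "y - offset d id k = y' - offset d id k"
      using eq[OF permutes_id] base_dedge[OF permutes_id k(1)] k(2) y y' 1 by metis
    then show ?thesis using y y' 1 by simp
  next
    case 2
    then show ?thesis using base_separates_last[OF y(1) y'(1), of i'] eq y y' by blast
  next
    case 3
    then show ?thesis using base_separates_last[OF y'(1) y(1), of i] eq y y' by metis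
  next
    case 4
    obtain \<xi> where \<xi>: "\<xi> permutes {1..d}" "\<xi> 1 = i" "\<xi> 2 = i'"
      using exists_permutation[OF 4(2,3,1)] .
    obtain \<nu> where \<nu>: "\<nu> permutes {1..d}" "\<nu> 1 = i'" "\<nu> 2 = i"
      using exists_permutation[OF 4(3,2)] 4(1) by blast
    have "y - gvec d (d + 1) = y' - (gvec d (d + 1) + gvec d i)"
      using eq[OF \<xi>(1)] base_dedge_012[OF \<xi>(1) y(1)] base_dedge_012[OF \<xi>(1) y'(1)] \<xi> y y' by simp
    then have 1: "y' = y + gvec d i" by (simp add: algebra_simps)
    have "y' - gvec d (d + 1) = y - (gvec d (d + 1) + gvec d i')"
      using eq[OF \<nu>(1)] base_dedge_012[OF \<nu>(1) y(1)] base_dedge_012[OF \<nu>(1) y'(1)] \<nu> y y' by simp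
    then have "y = y' + gvec d i'" by (simp add: algebra_simps)
    then have "y + (gvec d i + gvec d i') = y" using 1 by (simp add: add.assoc)
    then show ?thesis using gvec_add_nonzero[OF d2 y(2) y'(2)] by (metis add_cancel_left_right)
  qed
qed

lemma flip_edge_out: "i \<in> dirs d \<Longrightarrow> flip_edge d x (dedge d x i) = dedge d (x - gvec d i) i"
  by (auto simp: flip_edge_def out_star_def dedge_def algebra_simps)

lemma flip_edge_mem:
  assumes "e \<in> Y"
  shows "flip_edge d x e \<in> flip d x Y"
proof (cases "e \<in> out_star d x")
  case True
  then obtain i where "i \<in> dirs d" "e = dedge d x i" unfolding out_star_def by blast
  then show ?thesis by (auto simp: flip_edge_out flip_def in_star_def)
next
  case False
  then show ?thesis using assms by (simp add: flip_edge_def flip_def)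
qed

text \<open>On the loops of type \<open>\<xi>\<close> through \<open>x\<close>, a flip acts as the cyclic shift of the \<open>d + 1\<close>
  positions, so the sign of its action does not depend on \<open>\<xi>\<close>.\<close>

lemma flip_perm:
  assumes \<xi>: "\<xi> permutes {1..d}" and x: "x \<in> lattice_vertices d" and out: "out_star d x \<subseteq> M"
    and bij: "bij_betw (\<lambda>e. c (base d \<xi> e)) M {1..n}"
  obtains \<rho> where "\<rho> permutes {1..n}" "sign \<rho> = sign (cyc d)"
    "\<And>e. e \<in> M \<Longrightarrow> \<rho> (c (base d \<xi> e)) = c (base d \<xi> (flip_edge d x e))"
proof -
  define p where "p e = c (base d \<xi> e)" for e
  define \<iota> where "\<iota> k = p (dedge d x (step d \<xi> k))" for k
  have p: "bij_betw p M {1..n}" using bij by (simp add: p_def[abs_def])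
  have out_mem: "dedge d x (step d \<xi> k) \<in> out_star d x" if "k \<le> d" for k
    using step_mem[OF \<xi> that] by (simp add: out_star_def)
  have inj: "inj_on \<iota> {..d}"
  proof (rule inj_onI)
    fix k l assume kl: "k \<in> {..d}" "l \<in> {..d}" "\<iota> k = \<iota> l"
    then have "dedge d x (step d \<xi> k) = dedge d x (step d \<xi> l)"
      using out_mem out bij_betw_imp_inj_on[OF p] unfolding \<iota>_def inj_on_def by blast
    then have "step d \<xi> k = step d \<xi> l"
      using dedge_eq_iff[OF d2] step_mem[OF \<xi>] kl by (metis atMost_iff)
    then show "k = l" using step_inj[OF \<xi>] kl by simp
  qed
  have im: "\<iota> ` {..d} \<subseteq> {1..n}" using out_mem out bij_betwE[OF p] unfolding \<iota>_def by blast
  \<comment> \<open>The shift of positions, transported to the labels of the loops through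
    \<open>x\<close> and extended by the identity.\<close>
  define \<rho> where "\<rho> = map_permutation {..d} \<iota> (cyc d)"
  have \<rho>_im: "\<rho> permutes \<iota> ` {..d}"
    unfolding \<rho>_def by (intro map_permutation_permutes inj_on_imp_bij_betw inj cyc_permutes)
  have "\<rho> (p e) = p (flip_edge d x e)" if e: "e \<in> M" for e
  proof (cases "e \<in> out_star d x")
    case True
    then obtain i where i: "i \<in> dirs d" "e = dedge d x i" unfolding out_star_def by blast
    obtain k where k: "k \<le> d" "step d \<xi> k = i" using step_surj[OF \<xi> i(1)] .
    have "\<rho> (\<iota> k) = \<iota> (cyc d k)"
      unfolding \<rho>_def using inj k by (intro map_permutation_apply) auto
    also have "\<dots> = p (flip_edge d x e)"
      using base_in_edge[OF \<xi> k(1) x] i k flip_edge_out[OF i(1)] by (simp add: \<iota>_def p_def)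
    finally show ?thesis using i k by (simp add: \<iota>_def)
  next
    case False
    have "p e \<notin> \<iota> ` {..d}"
    proof
      assume "p e \<in> \<iota> ` {..d}"
      then obtain k where k: "k \<le> d" "p e = p (dedge d x (step d \<xi> k))" by (auto simp: \<iota>_def)
      then have "e = dedge d x (step d \<xi> k)"
        using out_mem[OF k(1)] out e bij_betw_imp_inj_on[OF p] unfolding inj_on_def by blast
      then show False using False out_mem[OF k(1)] by simp
    qed
    then show ?thesis using permutes_not_in[OF \<rho>_im] False by (simp add: flip_edge_def)
  qed
  moreover have "\<rho> permutes {1..n}" using \<rho>_im im by (rule permutes_subset)
  moreover have "sign \<rho> = sign (cyc d)"
    unfolding \<rho>_def using inj cyc_permutes by (intro sign_map_permutation) auto
  ultimately show thesis using that by (simp add: p_def)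
qed

section \<open>Loops and tilings restricted to a region\<close>

lemma loops_through_eq:
  assumes "e \<in> lattice_edges d"
  shows "loops_through d e = (\<lambda>\<xi>. loop_of d (base d \<xi> e) \<xi>) ` {\<xi>. \<xi> permutes {1..d}}"
proof -
  have "traverses d (loop_of d x \<xi>) e \<longleftrightarrow> base d \<xi> e = x"
    if "x \<in> lattice_vertices d" "\<xi> permutes {1..d}" for x \<xi>
    using traverses_loop_of[OF that] mem_loop_edges_iff_base[OF that(2) assms] by simp
  then show ?thesis unfolding loops_through_def unrooted_loops_iff
    using base_lattice assms by auto
qed

lemma loop_part_eq:
  assumes "\<xi> permutes {1..d}" "T \<in> tilings d"
  shows "loop_part d R T \<xi> = (\<lambda>e. loop_of d (base d \<xi> e) \<xi>) ` (T \<inter> edges_at d R)"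
proof -
  have "traverses d (loop_of d x \<xi>) e \<longleftrightarrow> base d \<xi> e = x"
    if "x \<in> lattice_vertices d" "e \<in> T" for x e
    using traverses_loop_of[OF that(1) assms(1)] mem_loop_edges_iff_base[OF assms(1)]
      tiling_subset[OF assms(2)] that(2) by blast
  moreover have "base d \<xi> e \<in> lattice_vertices d" if "e \<in> T" for e
    using that base_lattice[OF assms(1)] tiling_subset[OF assms(2)] by blast
  ultimately show ?thesis unfolding loop_part_def image_def by blast
qed

text \<open>Off \<open>edges_at d R\<close> the tilings coincide, and \<open>base d \<xi>\<close> is
  a bijection on each; the loops met inside are in both cases the complement of those met
  outside.\<close>

lemma base_image_tilings_of:
  assumes \<xi>: "\<xi> permutes {1..d}" and T: "T \<in> tilings d" and Y: "Y \<in> tilings_of d R T"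
  shows "base d \<xi> ` (Y \<inter> edges_at d R) = base d \<xi> ` (T \<inter> edges_at d R)"
proof -
  have Y': "Y \<in> tilings d" "Y - edges_at d R = T - edges_at d R" using Y by (auto simp: tilings_of_def)
  have *: "base d \<xi> ` (Z \<inter> edges_at d R) = lattice_vertices d - base d \<xi> ` (Z - edges_at d R)"
    if "Z \<in> tilings d" for Z
  proof -
    have bij: "bij_betw (base d \<xi>) Z (lattice_vertices d)" using that \<xi> by (rule tiling_bij)
    have "base d \<xi> ` (Z - (Z - edges_at d R)) = base d \<xi> ` Z - base d \<xi> ` (Z - edges_at d R)"
      by (rule inj_on_image_set_diff[OF bij_betw_imp_inj_on[OF bij]]) auto
    moreover have "Z - (Z - edges_at d R) = Z \<inter> edges_at d R" by blast
    ultimately show ?thesis using bij_betw_imp_surj_on[OF bij] by simp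
  qed
  show ?thesis using *[OF Y'(1)] *[OF T] Y'(2) by simp
qed

text \<open>\<open>M\<close> hits exactly the loops that \<open>T\<close> hits inside, so it can
  replace that part of \<open>T\<close> for every type at once.\<close>

lemma tilings_of_glue:
  assumes T: "T \<in> tilings d" and M: "M \<subseteq> edges_at d R"
    and bij: "\<And>\<xi>. \<xi> permutes {1..d} \<Longrightarrow> bij_betw (base d \<xi>) M (base d \<xi> ` (T \<inter> edges_at d R))"
  shows "(T - edges_at d R) \<union> M \<in> tilings_of d R T"
proof -
  have "(T - edges_at d R) \<union> M \<in> tilings d"
    unfolding tilings_iff
  proof (intro conjI allI impI)
    show "(T - edges_at d R) \<union> M \<subseteq> lattice_edges d"
      using tiling_subset[OF T] M by (auto simp: edges_at_def)
    fix \<xi> assume \<xi>: "\<xi> permutes {1..d}"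
    let ?E = "edges_at d R"
    have bT: "bij_betw (base d \<xi>) T (lattice_vertices d)" using T \<xi> by (rule tiling_bij)
    then have inj: "inj_on (base d \<xi>) T" by (rule bij_betw_imp_inj_on)
    have "bij_betw (base d \<xi>) (T - ?E) (base d \<xi> ` (T - ?E))"
      by (intro inj_on_imp_bij_betw inj_on_subset[OF inj]) auto
    moreover have "base d \<xi> ` (T - ?E) \<inter> base d \<xi> ` (T \<inter> ?E) = {}"
      using inj_on_image_Int[OF inj, of "T - ?E" "T \<inter> ?E"] by auto
    ultimately have "bij_betw (base d \<xi>) ((T - ?E) \<union> M)
        (base d \<xi> ` (T - ?E) \<union> base d \<xi> ` (T \<inter> ?E))"
      by (intro bij_betw_combine bij \<xi>)
    moreover have "base d \<xi> ` (T - ?E) \<union> base d \<xi> ` (T \<inter> ?E) = lattice_vertices d"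
      using bij_betw_imp_surj_on[OF bT] unfolding image_Un[symmetric]
      by (simp add: Un_commute[of "T - ?E"] Int_Diff_Un)
    ultimately show "bij_betw (base d \<xi>) ((T - ?E) \<union> M) (lattice_vertices d)" by simp
  qed
  then show ?thesis using M by (auto simp: tilings_of_def)
qed

lemma partition_function_matchings:
  "partition_function d R T w =
     (\<Sum>M\<in>(\<lambda>Y. Y \<inter> edges_at d R) ` tilings_of d R T. \<Prod>e\<in>M. w e)"
proof -
  have "inj_on (\<lambda>Y. Y \<inter> edges_at d R) (tilings_of d R T)"
    by (rule inj_onI) (auto simp: tilings_of_def)
  then show ?thesis unfolding partition_function_def by (simp add: sum.reindex)
qed

end

lemma prod_sign_cases:
  assumes "\<And>i. i \<in> I \<Longrightarrow> s i = 1 \<or> s i = (- 1 :: int)"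
  shows "(\<Prod>i\<in>I. of_int (s i) :: complex) = 1 \<or> (\<Prod>i\<in>I. of_int (s i) :: complex) = - 1"
  using assms
proof (induction I rule: infinite_finite_induct)
  case (insert i I)
  have "s i = 1 \<or> s i = - 1" using insert.prems by simp
  moreover have "(\<Prod>i\<in>I. of_int (s i) :: complex) = 1 \<or> (\<Prod>i\<in>I. of_int (s i) :: complex) = - 1"
    using insert by simp
  ultimately show ?case using insert.hyps by (elim disjE) simp_all
qed simp_all

theorem mainTheorem7:
  fixes d n :: nat and R :: "vertex set" and T :: "edge set" and w :: "edge \<Rightarrow> complex"
    and xi :: "nat \<Rightarrow> (nat \<Rightarrow> nat)" and a :: "nat \<Rightarrow> nat \<Rightarrow> unrooted_loop"
  assumes "d \<ge> 2"
    and "region d R"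
    and "T \<in> tilings d"
    and "bij_betw xi {1..fact d} {\<xi>. \<xi> permutes {1..d}}"
    and "n = card (T \<inter> edges_at d R)"
    and "\<And>i. i \<in> {1..fact d} \<Longrightarrow> bij_betw (a i) {1..n} (loop_part d R T (xi i))"
  shows "partition_function d R T w =
           hyperdet (fact d) n (\<lambda>t. kasteleyn d R w (\<lambda>i\<in>{1..fact d}. a i (t i)))
       \<or> partition_function d R T w =
           - hyperdet (fact d) n (\<lambda>t. kasteleyn d R w (\<lambda>i\<in>{1..fact d}. a i (t i)))"
proof -
  note d2 = assms(1) and T = assms(3) and a = assms(6)
  let ?E = "edges_at d R"
  define m where "m = (fact d :: nat)"
  define Lp where "Lp i e = loop_of d (base d (xi i) e) (xi i)" for i e
  define P where "P i e = inv_into {1..n} (a i) (Lp i e)" for i e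
  \<comment> \<open>Edges all of whose loops carry a label; for other edges in \<open>?E\<close>
    some \<open>P i e\<close> is a meaningless value of \<open>inv_into\<close>.\<close>
  define F where "F = {e \<in> ?E. \<forall>i\<in>{1..m}. Lp i e \<in> loop_part d R T (xi i)}"
  define MM where "MM = (\<lambda>Y. Y \<inter> ?E) ` tilings_of d R T"
  define A where "A t = kasteleyn d R w (\<lambda>i\<in>{1..m}. a i (t i))" for t
  have m: "1 \<le> m" by (simp add: m_def)
  note a = a[folded m_def]
  have xi: "xi i permutes {1..d}" if "i \<in> {1..m}" for i
    using bij_betwE[OF assms(4)] that unfolding m_def by blast
  have xi_surj: "\<exists>i\<in>{1..m}. \<xi> = xi i" if "\<xi> permutes {1..d}" for \<xi>
    using bij_betw_imp_surj_on[OF assms(4)] that unfolding m_def by blast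
  have E: "e \<in> lattice_edges d" if "e \<in> ?E" for e using that by (simp add: edges_at_def)
  have part: "loop_part d R T (xi i) = Lp i ` (T \<inter> ?E)" if "i \<in> {1..m}" for i
    unfolding Lp_def using loop_part_eq[OF d2 xi[OF that] T] .
  have Lp_eq: "Lp i e = Lp i e' \<longleftrightarrow> base d (xi i) e = base d (xi i) e'"
    if "i \<in> {1..m}" "e \<in> ?E" "e' \<in> ?E" for i e e'
    using loop_of_inj[OF d2 base_lattice[OF d2] _ base_lattice[OF d2], of "xi i" e "xi i" "xi i" e' "xi i"]
      xi[OF that(1)] E that unfolding Lp_def by auto
  have Lp_separates: "e = e'"
    if "e \<in> ?E" "e' \<in> ?E" "\<And>i. i \<in> {1..m} \<Longrightarrow> Lp i e = Lp i e'" for e e'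
  proof (rule base_separates[OF d2 E[OF that(1)] E[OF that(2)]])
    fix \<xi> assume "\<xi> permutes {1..d}"
    then obtain i where "i \<in> {1..m}" "\<xi> = xi i" using xi_surj by blast
    then show "base d \<xi> e = base d \<xi> e'" using Lp_eq that by blast
  qed
  have a_P: "a i (P i e) = Lp i e" if "e \<in> F" "i \<in> {1..m}" for i e
    using that bij_betw_inv_into_right[OF a[OF that(2)]] by (simp add: F_def P_def)
  have P_a: "P i e = k" if "i \<in> {1..m}" "k \<in> {1..n}" "a i k = Lp i e" for i e k
    using bij_betw_inv_into_left[OF a[OF that(1)] that(2)] that(3) by (simp add: P_def)
  have P_eq: "P i e = P i e' \<longleftrightarrow> base d (xi i) e = base d (xi i) e'"
    if "i \<in> {1..m}" "e \<in> F" "e' \<in> F" for i e e'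
  proof -
    have "P i e = P i e' \<longleftrightarrow> Lp i e = Lp i e'" using a_P that by (metis P_def)
    then show ?thesis using Lp_eq that by (simp add: F_def)
  qed
  \<comment> \<open>The hypermatrix compares sets of loops, \<open>hyperdet_matchings\<close>
    compares entries; as loops of different types differ, a tuple with one loop per type is
    determined by its set.\<close>
  have loops_iff: "s ` {1..m} = loops_through d e \<longleftrightarrow> (\<forall>i\<in>{1..m}. s i = Lp i e)"
    if e: "e \<in> ?E" and s: "\<And>i. i \<in> {1..m} \<Longrightarrow> s i \<in> loop_part d R T (xi i)" for s e
  proof -
    have lt: "loops_through d e = (\<lambda>i. Lp i e) ` {1..m}"
      unfolding loops_through_eq[OF d2 E[OF e]] bij_betw_imp_surj_on[OF assms(4), symmetric]
        Lp_def m_def image_image ..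
    show ?thesis
    proof
      assume "s ` {1..m} = loops_through d e"
      show "\<forall>i\<in>{1..m}. s i = Lp i e"
      proof
        fix i assume i: "i \<in> {1..m}"
        then have "s i \<in> (\<lambda>i. Lp i e) ` {1..m}" using \<open>s ` {1..m} = _\<close> lt by blast
        then obtain j where j: "j \<in> {1..m}" "s i = Lp j e" by blast
        obtain e' where e': "e' \<in> ?E" "s i = Lp i e'" using s[OF i] part[OF i] by blast
        have "xi i = xi j"
          using loop_of_inj[OF d2 base_lattice[OF d2 xi[OF i] E[OF e'(1)]] xi[OF i]
              base_lattice[OF d2 xi[OF j(1)] E[OF e]] xi[OF j(1)]] e' j
          unfolding Lp_def by metis
        then show "s i = Lp i e" using j by (simp add: Lp_def)
      qed
    next
      assume "\<forall>i\<in>{1..m}. s i = Lp i e"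
      then show "s ` {1..m} = loops_through d e" unfolding lt by (intro image_cong) auto
    qed
  qed
  have bij_Y: "bij_betw (P i) (Y \<inter> ?E) {1..n}" if Y: "Y \<in> tilings_of d R T" and i: "i \<in> {1..m}" for Y i
  proof -
    have "Y \<in> tilings d" using Y by (simp add: tilings_of_def)
    then have "inj_on (base d (xi i)) Y" using tiling_bij[OF d2 _ xi[OF i]] bij_betw_imp_inj_on by blast
    then have "inj_on (Lp i) (Y \<inter> ?E)" using Lp_eq[OF i] by (auto simp: inj_on_def)
    moreover have "Lp i ` (Y \<inter> ?E) = loop_part d R T (xi i)"
    proof -
      have "Lp i ` Z = (\<lambda>x. loop_of d x (xi i)) ` base d (xi i) ` Z" for Z
        by (simp add: image_image Lp_def)
      then show ?thesis unfolding part[OF i] using base_image_tilings_of[OF d2 xi[OF i] T Y] by simp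
    qed
    ultimately have "bij_betw (Lp i) (Y \<inter> ?E) (loop_part d R T (xi i))" by (simp add: bij_betw_def)
    then have "bij_betw (inv_into {1..n} (a i) \<circ> Lp i) (Y \<inter> ?E) {1..n}"
      using bij_betw_inv_into[OF a[OF i]] by (rule bij_betw_trans)
    then show ?thesis by (simp add: P_def[abs_def] comp_def)
  qed
  have Y_F: "Y \<inter> ?E \<subseteq> F" if Y: "Y \<in> tilings_of d R T" for Y
  proof
    fix e assume e: "e \<in> Y \<inter> ?E"
    have "Lp i e \<in> loop_part d R T (xi i)" if i: "i \<in> {1..m}" for i
    proof -
      have "base d (xi i) e \<in> base d (xi i) ` (T \<inter> ?E)"
        using base_image_tilings_of[OF d2 xi[OF i] T Y] e by blast
      then show ?thesis unfolding part[OF i] Lp_def by auto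
    qed
    then show "e \<in> F" using e by (simp add: F_def)
  qed
  have T_T: "T \<in> tilings_of d R T" using T by (simp add: tilings_of_def)
  have MM: "M \<in> MM \<longleftrightarrow> M \<subseteq> F \<and> (\<forall>i\<in>{1..m}. bij_betw (P i) M {1..n})" for M
  proof
    assume "M \<in> MM"
    then show "M \<subseteq> F \<and> (\<forall>i\<in>{1..m}. bij_betw (P i) M {1..n})"
      unfolding MM_def using bij_Y Y_F by blast
  next
    assume M: "M \<subseteq> F \<and> (\<forall>i\<in>{1..m}. bij_betw (P i) M {1..n})"
    then have ME: "M \<subseteq> ?E" by (auto simp: F_def)
    \<comment> \<open>\<open>P i\<close> has the same image on \<open>M\<close> as on
      \<open>T \<inter> ?E\<close>, so \<open>M\<close> meets the same loops as \<open>T\<close> in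
      every type and can be glued in.\<close>
    have "(T - ?E) \<union> M \<in> tilings_of d R T"
    proof (rule tilings_of_glue[OF d2 T ME])
      fix \<xi> assume "\<xi> permutes {1..d}"
      then obtain i where i: "i \<in> {1..m}" and \<xi>: "\<xi> = xi i" using xi_surj by blast
      have bij: "bij_betw (P i) M {1..n}" using M i by blast
      have TF: "T \<inter> ?E \<subseteq> F" by (rule Y_F[OF T_T])
      have iff: "P i e = P i e' \<longleftrightarrow> base d \<xi> e = base d \<xi> e'" if "e \<in> M \<union> (T \<inter> ?E)" "e' \<in> M \<union> (T \<inter> ?E)" for e e'
        unfolding \<xi> using P_eq[OF i] that M TF by blast
      have sub: "base d \<xi> ` A \<subseteq> base d \<xi> ` B"
        if "P i ` A = P i ` B" "A \<subseteq> M \<union> (T \<inter> ?E)" "B \<subseteq> M \<union> (T \<inter> ?E)" for A B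
      proof
        fix y assume "y \<in> base d \<xi> ` A"
        then obtain e where e: "e \<in> A" "y = base d \<xi> e" by blast
        then have "P i e \<in> P i ` B" unfolding that(1)[symmetric] by blast
        then obtain e' where "e' \<in> B" "P i e = P i e'" by blast
        then show "y \<in> base d \<xi> ` B" using iff[of e e'] e that(2,3) by blast
      qed
      have "P i ` M = P i ` (T \<inter> ?E)"
        using bij_betw_imp_surj_on[OF bij] bij_betw_imp_surj_on[OF bij_Y[OF T_T i]] by simp
      then have "base d \<xi> ` M = base d \<xi> ` (T \<inter> ?E)"
        using sub[of M "T \<inter> ?E"] sub[of "T \<inter> ?E" M] by auto
      moreover have "inj_on (base d \<xi>) M"
        using bij_betw_imp_inj_on[OF bij] iff by (auto simp: inj_on_def)
      ultimately show "bij_betw (base d \<xi>) M (base d \<xi> ` (T \<inter> ?E))" by (simp add: bij_betw_def)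
    qed
    moreover have "((T - ?E) \<union> M) \<inter> ?E = M" using ME by blast
    ultimately show "M \<in> MM" unfolding MM_def by (metis imageI)
  qed
  have A_eq: "A t = w e" if e: "e \<in> F" and t: "\<And>i. i \<in> {1..m} \<Longrightarrow> t i = P i e" for e t
  proof -
    let ?s = "\<lambda>i\<in>{1..m}. a i (t i)"
    have s: "?s i = Lp i e" if "i \<in> {1..m}" for i using a_P[OF e that] t[OF that] that by simp
    have eE: "e \<in> ?E" using e by (simp add: F_def)
    have iff: "?s ` {1..m} = loops_through d e' \<longleftrightarrow> e' = e" if "e' \<in> ?E" for e'
    proof -
      have "?s ` {1..m} = loops_through d e' \<longleftrightarrow> (\<forall>i\<in>{1..m}. ?s i = Lp i e')"
        using s e by (intro loops_iff that) (simp add: F_def)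
      also have "\<dots> \<longleftrightarrow> e' = e" using s Lp_separates[OF eE that] by fastforce
      finally show ?thesis .
    qed
    then have "(THE e'. e' \<in> ?E \<and> ?s ` {1..m} = loops_through d e') = e"
      using eE by (intro the_equality) blast+
    then show ?thesis unfolding A_def kasteleyn_def m_def[symmetric] using iff eE by auto
  qed
  have A_0: "A t = 0"
    if t: "\<And>i. i \<in> {1..m} \<Longrightarrow> t i \<in> {1..n}" and none: "\<not> (\<exists>e\<in>F. \<forall>i\<in>{1..m}. t i = P i e)" for t
  proof -
    let ?s = "\<lambda>i\<in>{1..m}. a i (t i)"
    have s: "?s i \<in> loop_part d R T (xi i)" if "i \<in> {1..m}" for i
      using bij_betwE[OF a[OF that]] t[OF that] that by simp
    have "\<not> (\<exists>e\<in>?E. ?s ` {1..m} = loops_through d e)"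
    proof
      assume "\<exists>e\<in>?E. ?s ` {1..m} = loops_through d e"
      then obtain e where eE: "e \<in> ?E" and "?s ` {1..m} = loops_through d e" by blast
      then have e: "\<forall>i\<in>{1..m}. ?s i = Lp i e" by (intro iffD1[OF loops_iff[OF eE s]])
      then have "e \<in> F" using eE s by (simp add: F_def)
      moreover have "t i = P i e" if "i \<in> {1..m}" for i
        using P_a[OF that t[OF that], of e] e that by simp
      ultimately show False using none by blast
    qed
    then show ?thesis unfolding A_def kasteleyn_def m_def[symmetric] by (simp only: if_False)
  qed
  \<comment> \<open>Every sign compares type \<open>xi i\<close> with the reference type
    \<open>xi 1\<close>.\<close>
  define sg where "sg i Y = sign (matching_perm n (P 1) (P i) (Y \<inter> ?E))" for i Y
  have sg_flip: "sg i (flip d x Y) = sg i Y"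
    if i: "i \<in> {1..m}" and Y: "Y \<in> tilings_of d R T" and x: "x \<in> R" and out: "out_star d x \<subseteq> Y" for i Y x
  proof -
    have xV: "x \<in> lattice_vertices d" using assms(2) x by (auto simp: region_def)
    note star = star_edges_at[OF d2 x xV]
    have Y': "flip d x Y \<in> tilings_of d R T" by (rule flip_tilings_of[OF d2 Y x xV out])
    have one: "1 \<in> {1..m}" using m by simp
    \<comment> \<open>Applied at index 1 and at index \<open>i\<close>; both relabellings have the
      sign of \<open>cyc d\<close>, as \<open>sign_matching_perm_cong\<close> requires.\<close>
    have ex: "\<exists>\<rho>. \<rho> permutes {1..n} \<and> sign \<rho> = sign (cyc d) \<and>
        (\<forall>e\<in>Y \<inter> ?E. \<rho> (P j e) = P j (flip_edge d x e))" if j: "j \<in> {1..m}" for j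
    proof -
      let ?c = "\<lambda>y. inv_into {1..n} (a j) (loop_of d y (xi j))"
      have "out_star d x \<subseteq> Y \<inter> ?E" using out star by blast
      moreover have "bij_betw (\<lambda>e. ?c (base d (xi j) e)) (Y \<inter> ?E) {1..n}"
        using bij_Y[OF Y j] by (simp add: P_def[abs_def] Lp_def)
      ultimately obtain \<rho> where "\<rho> permutes {1..n}" "sign \<rho> = sign (cyc d)"
        "\<And>e. e \<in> Y \<inter> ?E \<Longrightarrow> \<rho> (?c (base d (xi j) e)) = ?c (base d (xi j) (flip_edge d x e))"
        using flip_perm[OF d2 xi[OF j] xV, of "Y \<inter> ?E" ?c n] by blast
      then show ?thesis unfolding P_def Lp_def by blast
    qed
    obtain \<rho> where \<rho>: "\<rho> permutes {1..n}" "sign \<rho> = sign (cyc d)"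
      "\<And>e. e \<in> Y \<inter> ?E \<Longrightarrow> \<rho> (P 1 e) = P 1 (flip_edge d x e)" using ex[OF one] by blast
    obtain \<rho>' where \<rho>': "\<rho>' permutes {1..n}" "sign \<rho>' = sign (cyc d)"
      "\<And>e. e \<in> Y \<inter> ?E \<Longrightarrow> \<rho>' (P i e) = P i (flip_edge d x e)" using ex[OF i] by blast
    have "flip_edge d x e \<in> flip d x Y \<inter> ?E" if "e \<in> Y \<inter> ?E" for e
      using flip_edge_mem[OF d2, of e "Y \<inter> ?E" x] that star by (auto simp: flip_def)
    then show ?thesis unfolding sg_def
      using sign_matching_perm_cong[OF bij_Y[OF Y one] bij_Y[OF Y' one] bij_Y[OF Y i] bij_Y[OF Y' i]
          _ \<rho>(1,3) \<rho>'(1,3)] \<rho>(2) \<rho>'(2) by simp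
  qed
  have sgn: "sign (matching_perm n (P 1) (P i) M) = sg i T" if "M \<in> MM" "i \<in> {2..m}" for M i
  proof -
    obtain Y where Y: "Y \<in> tilings_of d R T" "M = Y \<inter> ?E" using \<open>M \<in> MM\<close> unfolding MM_def by blast
    have "sg i Y = sg i T"
      by (rule flip_invariant[OF d2 sg_flip assms(2) Y(1) T_T]) (use that(2) in auto)
    then show ?thesis unfolding sg_def Y(2) .
  qed
  have "hyperdet m n A = (\<Prod>i\<in>{2..m}. of_int (sg i T)) * (\<Sum>M\<in>MM. \<Prod>e\<in>M. w e)"
  proof (rule hyperdet_matchings[where F = F and P = P])
    show "e = e'" if "e \<in> F" "e' \<in> F" "\<And>i. i \<in> {1..m} \<Longrightarrow> P i e = P i e'" for e e'
    proof (rule Lp_separates)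
      show "e \<in> ?E" "e' \<in> ?E" using that by (simp_all add: F_def)
      show "Lp i e = Lp i e'" if "i \<in> {1..m}" for i
        using a_P[OF \<open>e \<in> F\<close> that] a_P[OF \<open>e' \<in> F\<close> that] \<open>\<And>i. i \<in> {1..m} \<Longrightarrow> P i e = P i e'\<close>[OF that]
        by simp
    qed
  qed (fact m MM A_eq A_0 sgn)+
  also have "(\<Sum>M\<in>MM. \<Prod>e\<in>M. w e) = partition_function d R T w"
    unfolding MM_def by (rule partition_function_matchings[OF d2, symmetric])
  finally have det: "hyperdet m n A = (\<Prod>i\<in>{2..m}. of_int (sg i T)) * partition_function d R T w" .
  have "(\<Prod>i\<in>{2..m}. of_int (sg i T) :: complex) = 1 \<or> (\<Prod>i\<in>{2..m}. of_int (sg i T) :: complex) = - 1"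
    by (rule prod_sign_cases) (auto simp: sg_def sign_def)
  then have "partition_function d R T w = hyperdet m n A \<or> partition_function d R T w = - hyperdet m n A"
    unfolding det by auto
  then show ?thesis unfolding A_def m_def .
qed

end
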